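(* Let $0<a\leq 1$. The harmonic Hurwitz zeta function $\zeta_H(s,a)$ has the following Laurent expansion in the annulus $0<|s-1|<1$: $$\zeta_H(s,a)=\frac{1}{(s-1)^2}+\frac{\gamma(0,a)}{s-1}+\sum_{m=0}^{\infty}(-1)^m\frac{\gamma_H(m,a)}{m!}(s-1)^m,$$ where, for every integer $m\ge 0$, the coefficient $\gamma_H(m,a)$ is given by $$\gamma_H(m,a)=\lim_{x\to\infty}\left(\sum_{0\le n\leq x}\frac{H_n(a)\log^m(n+a)}{n+a}-\frac{\log^{m+2}(x+a)}{m+2}-\gamma(0,a)\frac{\log^{m+1}(x+a)}{m+1}\right).$$
   Context: For $a\in\mathbb{C}\setminus\{0,-1,-2,\ldots\}$ and integer $n\ge 0$, $H_n(a)=\sum_{k=0}^{n}\frac{1}{k+a}$. The harmonic Hurwitz zeta function is $\zeta_H(s,a)=\sum_{n=0}^{\infty}\frac{H_n(a)}{(n+a)^s}$ for $\operatorname{Re}(s)>1$; the same symbol denotes its meromorphic continuation to the complex $s$-plane, which has a double pole at $s=1$ and otherwise at most simple poles at $s=0$ and $s=1-2j$, $j=1,2,\ldots$. The constant $\gamma(0,a)$ is the constant term in the Laurent expansion at $s=1$ of the Hurwitz zeta function $\zeta(s,a)=\sum_{n=0}^\infty (n+a)^{-s}$, i.e. $\zeta(s,a)=\frac{1}{s-1}+\gamma(0,a)+O(s-1)$ (equivalently $\gamma(0,a)=-\psi(a)$ with $\psi=\Gamma'/\Gamma$). The sum in the limit runs over integers $n$ with $0\le n\le x$. *)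

theory Defs
  imports "HOL-Complex_Analysis.Complex_Analysis"
begin

text \<open>
  The meromorphic continuation to the whole plane of a function given on \<open>A\<close>.
  By the identity theorem there is at most one such \<open>g\<close> as soon as \<open>A\<close> is open and nonempty:
  \<^const>\<open>nicely_meromorphic_on\<close> forces removable singularities to be removed and fixes the value
  at each pole to be \<open>0\<close>.
\<close>

definition meromorphic_continuation :: "complex set \<Rightarrow> (complex \<Rightarrow> complex) \<Rightarrow> complex \<Rightarrow> complex" where
  "meromorphic_continuation A f =
     (SOME g. g nicely_meromorphic_on UNIV \<and> (\<forall>s\<in>A. g s = f s))"

definition harmonic_sum :: "nat \<Rightarrow> complex \<Rightarrow> complex" where
  "harmonic_sum n a = (\<Sum>k\<le>n. 1 / (of_nat k + a))"

text \<open>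
  The powers and logarithms below are principal values; for real \<open>a > 0\<close> they are the usual real
  powers and logarithms of the positive base.
\<close>

definition hurwitz_zeta :: "complex \<Rightarrow> complex \<Rightarrow> complex" where
  "hurwitz_zeta s a =
     meromorphic_continuation {s. Re s > 1} (\<lambda>s. \<Sum>n. (of_nat n + a) powr (-s)) s"

definition harmonic_hurwitz_zeta :: "complex \<Rightarrow> complex \<Rightarrow> complex" where
  "harmonic_hurwitz_zeta s a =
     meromorphic_continuation {s. Re s > 1}
       (\<lambda>s. \<Sum>n. harmonic_sum n a / (of_nat n + a) powr s) s"

definition gamma0 :: "complex \<Rightarrow> complex" where
  "gamma0 a = fls_nth (laurent_expansion (\<lambda>s. hurwitz_zeta s a) 1) 0"

definition gamma_H_approx :: "nat \<Rightarrow> complex \<Rightarrow> real \<Rightarrow> complex" where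
  "gamma_H_approx m a x =
     (\<Sum>n | real n \<le> x. harmonic_sum n a * ln (of_nat n + a) ^ m / (of_nat n + a))
     - ln (of_real x + a) ^ (m + 2) / of_nat (m + 2)
     - gamma0 a * ln (of_real x + a) ^ (m + 1) / of_nat (m + 1)"

definition gamma_H :: "nat \<Rightarrow> complex \<Rightarrow> complex" where
  "gamma_H m a = Lim at_top (gamma_H_approx m a)"

end

theory Submission
  imports Defs "HOL-Real_Asymp.Real_Asymp"
begin

text \<open>
  Both zeta functions are Dirichlet series \<open>D(s) = \<Sum>n. c n * (n + a) powr (-s)\<close> with
  \<open>c n = \<alpha> * ln (n + a) + \<beta> + O(1 / (n + a))\<close>: for the Hurwitz zeta function
  \<open>(\<alpha>, \<beta>) = (0, 1)\<close>, and for the harmonic one \<open>(\<alpha>, \<beta>) = (1, \<gamma>(0, a))\<close>.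

  Near \<open>s = 1\<close>, the partial sums of \<open>D(s)\<close> are compared with the integral of
  \<open>t powr (-s) * (\<alpha> * ln t + \<beta>)\<close> over \<open>[1, N + a]\<close>, which is entire in \<open>s\<close>. The
  difference converges locally uniformly for \<open>Re s > 0\<close>, so its derivatives at \<open>s = 1\<close>
  converge as well, and these are the limits that define \<open>\<gamma>\<^sub>H(m, a)\<close>.

  The continuation to the whole plane comes from
  \<open>\<Sum>n. c n * ((n + a) powr (1 - s) - (n + 1 + a) powr (1 - s)) = T(s)\<close>: expanding the
  second power by Taylor's formula expresses \<open>(s - 1) * D(s)\<close> by \<open>T(s)\<close>, shifts
  \<open>D(s + 1), D(s + 2), \<dots>\<close> and a remainder that is holomorphic further to the left. Here
  \<open>T(s)\<close> is \<open>a powr (1 - s)\<close> for the Hurwitz zeta function, and summation by parts shows that it is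
  \<open>\<zeta>(s, a)\<close> for the harmonic one.
\<close>

subsection \<open>Locally dominated series and meromorphic continuation\<close>

text \<open>The Weierstrass M-test on small closed balls. A bound on the tail suffices, which suits
  coefficient bounds that hold only for large \<open>n\<close>. The third conclusion keeps the
  uniform convergence itself, so that the series can later be differentiated term by term.\<close>

lemma holomorphic_suminf_locally_dominated:
  fixes f :: "nat \<Rightarrow> complex \<Rightarrow> complex"
  assumes S: "open S" and hol: "\<And>n. f n holomorphic_on S"
    and dom: "\<And>z. z \<in> S \<Longrightarrow> \<exists>r>0. cball z r \<subseteq> S \<and>
      (\<exists>M. summable M \<and> (\<forall>\<^sub>F n in sequentially. \<forall>w\<in>cball z r. norm (f n w) \<le> M n))"
  shows "(\<lambda>z. \<Sum>n. f n z) holomorphic_on S"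
    and "\<And>z. z \<in> S \<Longrightarrow> summable (\<lambda>n. f n z)"
    and "\<And>z. z \<in> S \<Longrightarrow> \<exists>r>0. cball z r \<subseteq> S \<and>
      uniform_limit (cball z r) (\<lambda>n w. \<Sum>i<n. f i w) (\<lambda>w. \<Sum>n. f n w) sequentially"
proof -
  show ul: "\<exists>r>0. cball z r \<subseteq> S \<and>
      uniform_limit (cball z r) (\<lambda>n w. \<Sum>i<n. f i w) (\<lambda>w. \<Sum>n. f n w) sequentially"
    if z: "z \<in> S" for z
    proof -
    obtain r M where r: "r > 0" "cball z r \<subseteq> S" "summable M"
      and M: "\<forall>\<^sub>F n in sequentially. \<forall>w\<in>cball z r. norm (f n w) \<le> M n"
      using dom[OF z] by blast
    show ?thesis using r Weierstrass_m_test_ev[OF M r(3)] by blast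
  qed
  show "(\<lambda>z. \<Sum>n. f n z) holomorphic_on S"
    by (rule holomorphic_uniform_sequence[where f = "\<lambda>n w. \<Sum>i<n. f i w"])
       (use S ul in \<open>auto intro!: holomorphic_intros hol\<close>)
  show "summable (\<lambda>n. f n z)" if z: "z \<in> S" for z
  proof -
    obtain r M where r: "r > 0" "summable M"
      and M: "\<forall>\<^sub>F n in sequentially. \<forall>w\<in>cball z r. norm (f n w) \<le> M n"
      using dom[OF z] by blast
    have "\<forall>\<^sub>F n in sequentially. norm (f n z) \<le> M n"
      using M by eventually_elim (use r in auto)
    thus ?thesis using r(2) by (rule summable_comparison_test_ev)
  qed
qed

text \<open>On a connected open set the meromorphic function \<open>f - g\<close> either vanishes
  off a sparse set or is nonzero off a sparse set. Agreement near \<open>z0\<close> excludes the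
  second case.\<close>

lemma meromorphic_eventually_eq:
  assumes f: "f meromorphic_on A" and g: "g meromorphic_on A" and A: "open A" "connected A"
    and z0: "z0 \<in> A" "\<forall>\<^sub>F z in at z0. f z = g z" and z: "z \<in> A"
  shows "\<forall>\<^sub>F w in at z. f w = g w"
proof -
  have "(\<lambda>z. f z - g z) meromorphic_on A"
    by (intro meromorphic_intros f g)
  hence "(\<forall>\<^sub>\<approx>x\<in>A. f x - g x = 0) \<or> (\<forall>\<^sub>\<approx>x\<in>A. f x - g x \<noteq> 0)"
    using A by (rule meromorphic_imp_constant_or_avoid)
  moreover have "\<not> (\<forall>\<^sub>\<approx>x\<in>A. f x - g x \<noteq> 0)"
  proof
    assume "\<forall>\<^sub>\<approx>x\<in>A. f x - g x \<noteq> 0"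
    hence "\<forall>\<^sub>F z in at z0. f z - g z \<noteq> 0"
      using z0(1) by (rule eventually_cosparse_imp_eventually_at)
    hence "\<forall>\<^sub>F z in at z0. False"
      using z0(2) by eventually_elim auto
    thus False by simp
  qed
  ultimately have "\<forall>\<^sub>\<approx>x\<in>A. f x - g x = 0" by blast
  hence "\<forall>\<^sub>F z in at z. f z - g z = 0"
    using z by (rule eventually_cosparse_imp_eventually_at)
  thus ?thesis by simp
qed

text \<open>Equality on a punctured neighbourhood of \<open>z\<close> transfers both poles and
  limits, and these determine the value of a nicely meromorphic function: 0 at a pole, the limit
  elsewhere.\<close>

lemma nicely_meromorphic_eq:
  assumes f: "f nicely_meromorphic_on A" and g: "g nicely_meromorphic_on A"
    and A: "open A" "connected A"
    and z0: "z0 \<in> A" "\<forall>\<^sub>F z in at z0. f z = g z" and z: "z \<in> A"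
  shows "f z = g z"
proof -
  have ev: "\<forall>\<^sub>F w in at z. f w = g w"
    using f g by (intro meromorphic_eventually_eq[OF _ _ A z0 z]) (auto simp: nicely_meromorphic_on_def)
  have pole: "is_pole f z \<longleftrightarrow> is_pole g z"
    using ev by (intro is_pole_cong) auto
  have lim: "(f \<longlongrightarrow> l) (at z) \<longleftrightarrow> (g \<longlongrightarrow> l) (at z)" for l
    using ev by (rule tendsto_cong)
  have "is_pole f z \<and> f z = 0 \<or> f \<midarrow>z\<rightarrow> f z" "is_pole g z \<and> g z = 0 \<or> g \<midarrow>z\<rightarrow> g z"
    using f g z by (auto simp: nicely_meromorphic_on_def)
  moreover have "\<not> (is_pole f z \<and> f \<midarrow>z\<rightarrow> l)" for l
    using is_pole_def not_tendsto_and_filterlim_at_infinity trivial_limit_at by metis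
  ultimately show ?thesis
    using pole lim LIM_unique by metis
qed

text \<open>A variant for an explicit formula \<open>f\<close>, whose value at a singularity is an
  artefact of division by zero. Where \<open>f\<close> is continuous, its value is the limit that
  \<open>g\<close> must take.\<close>

lemma nicely_meromorphic_eq_isCont:
  assumes g: "g nicely_meromorphic_on A" and f: "f meromorphic_on A"
    and A: "open A" "connected A"
    and z0: "z0 \<in> A" "\<forall>\<^sub>F z in at z0. g z = f z" and z: "z \<in> A" and cont: "isCont f z"
  shows "g z = f z"
proof -
  have ev: "\<forall>\<^sub>F w in at z. g w = f w"
    using f g by (intro meromorphic_eventually_eq[OF _ _ A z0 z]) (auto simp: nicely_meromorphic_on_def)
  have lim: "g \<midarrow>z\<rightarrow> f z"
    using cont ev by (metis isContD tendsto_cong)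
  hence "\<not> is_pole g z"
    using is_pole_def not_tendsto_and_filterlim_at_infinity trivial_limit_at by metis
  thus ?thesis
    using lim g z LIM_unique by (metis nicely_meromorphic_on_def)
qed

lemma meromorphic_continuationI:
  assumes "g nicely_meromorphic_on UNIV" "\<And>s. s \<in> A \<Longrightarrow> g s = f s"
  shows "meromorphic_continuation A f nicely_meromorphic_on UNIV"
    and "s \<in> A \<Longrightarrow> meromorphic_continuation A f s = f s"
proof -
  have "\<exists>g. g nicely_meromorphic_on UNIV \<and> (\<forall>s\<in>A. g s = f s)"
    using assms by blast
  from someI_ex[OF this] show "meromorphic_continuation A f nicely_meromorphic_on UNIV"
    and "s \<in> A \<Longrightarrow> meromorphic_continuation A f s = f s"
    by (auto simp: meromorphic_continuation_def)
qed

text \<open>Once removable singularities are removed, the continuations to the half planes agree on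
  overlaps by the identity theorem. The value at \<open>s\<close> may thus be read off from any half
  plane that contains \<open>s\<close>.\<close>

lemma nicely_meromorphic_glue_half_planes:
  assumes mero: "\<And>K::nat. \<exists>g. g meromorphic_on {s. Re s > 1 - real K} \<and> (\<forall>s. Re s > 1 \<longrightarrow> g s = D s)"
    and D: "D holomorphic_on {s. Re s > 1}"
  shows "\<exists>g. g nicely_meromorphic_on UNIV \<and> (\<forall>s\<in>{s. Re s > 1}. g s = D s)"
proof -
  define H where "H = (\<lambda>K::nat. {s. Re s > 1 - real K})"
  have H: "open (H K)" "connected (H K)" for K
    unfolding H_def using open_halfspace_Re_gt[of "1 - real K"] convex_halfspace_Re_gt[of "1 - real K"]
    by (auto intro: convex_connected)
  have "\<exists>g. g nicely_meromorphic_on H K \<and> (\<forall>s. Re s > 1 \<longrightarrow> g s = D s)" for K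
  proof -
    obtain g where g: "g meromorphic_on H K" "\<And>s. Re s > 1 \<Longrightarrow> g s = D s"
      using mero[of K] unfolding H_def by blast
    have "remove_sings g s = D s" if "Re s > 1" for s
    proof -
      have "g holomorphic_on {s. Re s > 1}"
        using D g(2) by (metis (mono_tags, lifting) holomorphic_transform mem_Collect_eq)
      hence "g analytic_on {s}"
        using that open_halfspace_Re_gt[of 1] analytic_at by blast
      thus ?thesis using g(2)[OF that] by simp
    qed
    thus ?thesis using remove_sings_nicely_meromorphic[OF g(1)] by blast
  qed
  then obtain G where G: "\<And>K. G K nicely_meromorphic_on H K" "\<And>K s. Re s > 1 \<Longrightarrow> G K s = D s"
    by metis
  \<comment> \<open>The point 2 lies in every \<open>H K\<close>, and near it all \<open>G K\<close>
    equal \<open>D\<close>; it serves as base point for the identity theorem.\<close>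
  have ev: "\<forall>\<^sub>F s in at (2::complex). Re s > 1"
    using open_halfspace_Re_gt[of 1] by (auto intro: eventually_at_in_open' [where A = "{s. Re s > 1}", simplified])
  have agree: "G K s = G L s" if "s \<in> H K" "s \<in> H L" for K L s
  proof -
    define M where "M = min K L"
    have sub: "H M \<subseteq> H K" "H M \<subseteq> H L" and s: "s \<in> H M" and two: "2 \<in> H M"
      using that by (auto simp: H_def M_def)
    show ?thesis
    proof (rule nicely_meromorphic_eq[OF _ _ H two _ s])
      show "G K nicely_meromorphic_on H M" "G L nicely_meromorphic_on H M"
        using G(1) sub nicely_meromorphic_on_subset by blast+
      show "\<forall>\<^sub>F z in at 2. G K z = G L z"
        using ev by eventually_elim (simp add: G(2))
    qed
  qed
  define k where "k = (\<lambda>s. SOME K. s \<in> H K)"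
  have ex: "\<exists>K. s \<in> H K" for s
    unfolding H_def using reals_Archimedean2[of "1 - Re s"] by (auto simp: algebra_simps)
  have k: "s \<in> H (k s)" for s
    unfolding k_def using ex by (rule someI_ex)
  define g where "g = (\<lambda>s. G (k s) s)"
  have geq: "g s = G K s" if "s \<in> H K" for s K
    unfolding g_def using agree k that by blast
  have nice: "g meromorphic_on {z} \<and> (is_pole g z \<and> g z = 0 \<or> g \<midarrow>z\<rightarrow> g z)" for z
  proof -
    obtain K where K: "z \<in> H K" using ex by blast
    have "\<forall>\<^sub>F s in at z. s \<in> H K"
      using H(1) K by (rule eventually_at_in_open')
    hence ev: "\<forall>\<^sub>F s in at z. g s = G K s"
      by eventually_elim (rule geq)
    have "G K meromorphic_on {z}"
      using G(1)[of K] K by (auto simp: nicely_meromorphic_on_def intro: meromorphic_on_subset)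
    hence "g meromorphic_on {z}"
      using ev by (subst meromorphic_on_cong) auto
    moreover have "is_pole g z \<longleftrightarrow> is_pole (G K) z"
      using ev by (intro is_pole_cong) auto
    moreover have "(g \<longlongrightarrow> l) (at z) \<longleftrightarrow> (G K \<longlongrightarrow> l) (at z)" for l
      using ev by (rule tendsto_cong)
    ultimately show ?thesis
      using G(1)[of K] K geq[OF K] by (auto simp: nicely_meromorphic_on_def)
  qed
  have "g nicely_meromorphic_on UNIV"
    using nice meromorphic_on_meromorphic_at[of g UNIV] unfolding nicely_meromorphic_on_def by blast
  moreover have "g s = D s" if "Re s > 1" for s
    using geq[of s 0] G(2)[OF that] that by (auto simp: H_def)
  ultimately show ?thesis by blast
qed

subsection \<open>Series with logarithmically growing coefficients\<close>

text \<open>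
  \<open>z ^ j * exp_primitive j z\<close> is the integral of \<open>u ^ (j - 1) * exp u\<close> over \<open>[0, z]\<close>; dividing by
  \<open>z ^ j\<close> gives a function that is regular at \<open>0\<close>.
\<close>

definition exp_primitive_fps :: "nat \<Rightarrow> complex fps" where
  "exp_primitive_fps j = Abs_fps (\<lambda>m. 1 / (fact m * of_nat (m + j)))"

definition exp_primitive :: "nat \<Rightarrow> complex \<Rightarrow> complex" where
  "exp_primitive j z = eval_fps (exp_primitive_fps j) z"

lemma fps_conv_radius_exp_primitive [simp]: "fps_conv_radius (exp_primitive_fps j) = \<infinity>"
  unfolding fps_conv_radius_def
proof (rule conv_radius_inftyI'')
  fix z :: complex
  show "summable (\<lambda>n. fps_nth (exp_primitive_fps j) n * z ^ n)"
  proof (rule summable_comparison_test[OF _ summable_norm_exp[of z]], intro exI allI impI)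
    fix n :: nat assume "n \<ge> 1"
    hence "norm z ^ n / (fact n * (real n + real j)) \<le> norm z ^ n / fact n"
      by (intro divide_left_mono) auto
    thus "norm (fps_nth (exp_primitive_fps j) n * z ^ n) \<le> norm (z ^ n /\<^sub>R fact n)"
      by (simp add: exp_primitive_fps_def norm_mult norm_divide norm_power divide_simps mult_ac
          flip: of_nat_add)
  qed
qed

text \<open>The derivative of \<open>z ^ j * exp_primitive j z\<close> should be
  \<open>z ^ (j - 1) * exp z\<close>. Dividing by \<open>z ^ (j - 1)\<close> gives this differential
  equation, which is checked coefficientwise: the factor \<open>m + j\<close> cancels the
  denominator.\<close>

lemma exp_primitive_deriv_fps:
  assumes "j > 0"
  shows "fps_const (of_nat j) * exp_primitive_fps j + fps_X * fps_deriv (exp_primitive_fps j) = fps_exp 1"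
proof (rule fps_ext)
  fix n
  have nz: "of_nat n + of_nat j \<noteq> (0::complex)"
    using assms by (metis add_is_0 less_irrefl of_nat_add of_nat_eq_0_iff)
  have "fps_nth (fps_const (of_nat j) * exp_primitive_fps j + fps_X * fps_deriv (exp_primitive_fps j)) n
      = (of_nat j + of_nat n) * fps_nth (exp_primitive_fps j) n"
    by (cases n) (auto simp: algebra_simps)
  also have "\<dots> = fps_nth (fps_exp 1) n"
    using nz by (simp add: exp_primitive_fps_def divide_simps add.commute)
  finally show "fps_nth (fps_const (of_nat j) * exp_primitive_fps j
      + fps_X * fps_deriv (exp_primitive_fps j)) n = fps_nth (fps_exp 1) n" .
qed

lemma has_field_derivative_exp_primitive:
  "(exp_primitive j has_field_derivative eval_fps (fps_deriv (exp_primitive_fps j)) z) (at z within A)"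
  unfolding exp_primitive_def by (intro has_field_derivative_eval_fps) simp

lemma exp_primitive_deriv:
  assumes "j > 0"
  shows "of_nat j * exp_primitive j z + z * eval_fps (fps_deriv (exp_primitive_fps j)) z = exp z"
proof -
  have r: "fps_conv_radius (fps_deriv (exp_primitive_fps j)) = \<infinity>"
    using fps_conv_radius_deriv[of "exp_primitive_fps j"] by simp
  have r2: "fps_conv_radius (fps_const (of_nat j) * exp_primitive_fps j) = \<infinity>"
    using fps_conv_radius_mult[of "fps_const (of_nat j)" "exp_primitive_fps j"] by simp
  have r3: "fps_conv_radius (fps_X * fps_deriv (exp_primitive_fps j)) = \<infinity>"
    using fps_conv_radius_mult[of fps_X "fps_deriv (exp_primitive_fps j)"] r by simp
  have "exp z = eval_fps (fps_const (of_nat j) * exp_primitive_fps j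
      + fps_X * fps_deriv (exp_primitive_fps j)) z"
    by (simp add: exp_primitive_deriv_fps[OF assms] eval_fps_exp)
  thus ?thesis
    by (simp add: eval_fps_add eval_fps_mult r r2 r3 exp_primitive_def)
qed

lemma exp_primitive_1: "z * exp_primitive 1 z = exp z - 1"
proof -
  have "fps_X * exp_primitive_fps 1 = fps_exp 1 - 1"
  proof (rule fps_ext)
    fix n show "fps_nth (fps_X * exp_primitive_fps 1) n = fps_nth (fps_exp 1 - 1) n"
      by (cases n) (auto simp: exp_primitive_fps_def algebra_simps)
  qed
  hence "eval_fps (fps_X * exp_primitive_fps 1) z = eval_fps (fps_exp 1 - 1) z" by simp
  thus ?thesis
    by (simp add: eval_fps_mult eval_fps_diff exp_primitive_def eval_fps_exp)
qed

text \<open>Both sides have derivative \<open>z * exp z\<close>, the left one by the differential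
  equation for \<open>j = 2\<close>, and both vanish at 0.\<close>

lemma exp_primitive_2: "z\<^sup>2 * exp_primitive 2 z = z * exp z - exp z + 1"
proof -
  have "((\<lambda>z. z\<^sup>2 * exp_primitive 2 z - (z * exp z - exp z + 1)) has_field_derivative 0) (at z)" for z
    using exp_primitive_deriv[of 2 z]
    by (auto intro!: derivative_eq_intros has_field_derivative_exp_primitive)
       (simp add: power2_eq_square algebra_simps, metis distrib_left)
  hence "\<exists>k. \<forall>z. z\<^sup>2 * exp_primitive 2 z - (z * exp z - exp z + 1) = k"
    using has_field_derivative_zero_constant[of UNIV "\<lambda>z. z\<^sup>2 * exp_primitive 2 z - (z * exp z - exp z + 1)"]
    by auto
  then obtain k where "\<And>z. z\<^sup>2 * exp_primitive 2 z - (z * exp z - exp z + 1) = k" by blast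
  from this[of z] this[of 0] show ?thesis by simp
qed

section \<open>Growth of the coefficients and convergence for Re s > 1\<close>

lemma summable_shifted_powr:
  fixes a d :: real
  assumes "d > 0"
  shows "summable (\<lambda>n. (real n + a) powr (-1 - d))"
proof (rule summable_comparison_test_bigo)
  show "summable (\<lambda>n. norm (real n powr (-1 - d)))"
    using assms by (simp add: summable_real_powr_iff)
  show "(\<lambda>n. (real n + a) powr (-1 - d)) \<in> O(\<lambda>n. real n powr (-1 - d))"
    by real_asymp
qed

locale logarithmic_coefficients =
  fixes a :: real and c :: "nat \<Rightarrow> complex" and \<alpha> \<beta> :: complex and C :: real
  assumes a_pos: "a > 0"
    and coeff_asymp: "\<And>n. norm (c n - (\<alpha> * of_real (ln (real n + a)) + \<beta>)) \<le> C / (real n + a)"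
begin

lemma coeff_growth:
  assumes "e > 0"
  shows "\<forall>\<^sub>F n in sequentially. norm (c n) \<le> (real n + a) powr e"
proof -
  \<comment> \<open>The added 1 makes \<open>A\<close> strictly positive even when
    \<open>\<alpha>\<close> is 0, so the sign needed for the asymptotic comparison is known.\<close>
  define A where "A = norm \<alpha> + 1"
  have A: "A > 0" by (simp add: A_def add_nonneg_pos)
  define B where "B = norm \<beta>"
  have "\<forall>\<^sub>F n in sequentially. C / (real n + a) + A * ln (real n + a) + B \<le> (real n + a) powr e"
    using A assms by real_asymp
  moreover have "\<forall>\<^sub>F n in sequentially. real n \<ge> 1"
    by real_asymp
  ultimately show ?thesis
  proof eventually_elim
    case (elim n)
    have l: "ln (real n + a) \<ge> 0" using elim a_pos by simp
    have "norm (c n) \<le> norm (c n - (\<alpha> * of_real (ln (real n + a)) + \<beta>))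
        + norm (\<alpha> * of_real (ln (real n + a)) + \<beta>)"
      using norm_triangle_ineq[of "c n - (\<alpha> * of_real (ln (real n + a)) + \<beta>)"
          "\<alpha> * of_real (ln (real n + a)) + \<beta>"] by simp
    also have "norm (\<alpha> * of_real (ln (real n + a)) + \<beta>) \<le> norm \<alpha> * ln (real n + a) + norm \<beta>"
      using l by (metis norm_triangle_ineq norm_mult norm_of_real abs_of_nonneg)
    finally have "norm (c n) \<le> C / (real n + a) + (norm \<alpha> * ln (real n + a) + norm \<beta>)"
      using coeff_asymp[of n] by simp
    also have "\<dots> \<le> C / (real n + a) + A * ln (real n + a) + B"
      using l by (simp add: A_def B_def algebra_simps)
    finally show ?case using elim by simp
  qed
qed

text \<open>The exponent \<open>-1 - 2 * d\<close> leaves room for the coefficients: they are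
  eventually at most \<open>(n + a) powr d\<close>, and the remaining exponent \<open>-1 - d\<close>
  is still summable.\<close>

lemma dominated:
  fixes f :: "nat \<Rightarrow> complex \<Rightarrow> complex"
  assumes d: "d > 0" and "B \<ge> 0"
    and f: "\<forall>\<^sub>F n in sequentially. \<forall>w\<in>X. norm (f n w) \<le> norm (c n) * (B * (real n + a) powr (-1 - 2 * d))"
  shows "\<exists>M. summable M \<and> (\<forall>\<^sub>F n in sequentially. \<forall>w\<in>X. norm (f n w) \<le> M n)"
proof (intro exI conjI)
  show "summable (\<lambda>n. B * (real n + a) powr (-1 - d))"
    using summable_shifted_powr[OF d] by (rule summable_mult)
  show "\<forall>\<^sub>F n in sequentially. \<forall>w\<in>X. norm (f n w) \<le> B * (real n + a) powr (-1 - d)"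
    using f coeff_growth[OF d]
  proof eventually_elim
    case (elim n)
    have "norm (c n) * (B * (real n + a) powr (-1 - 2 * d))
        \<le> (real n + a) powr d * (B * (real n + a) powr (-1 - 2 * d))"
      using elim \<open>B \<ge> 0\<close> by (intro mult_right_mono) auto
    also have "\<dots> = B * ((real n + a) powr d * (real n + a) powr (-1 - 2 * d))"
      by (simp only: mult_ac)
    also have "(real n + a) powr d * (real n + a) powr (-1 - 2 * d) = (real n + a) powr (-1 - d)"
      by (subst powr_add [symmetric]) (simp add: algebra_simps)
    finally show ?case using elim by force
  qed
qed

definition series :: "complex \<Rightarrow> complex" where
  "series s = (\<Sum>n. c n * of_real (real n + a) powr (-s))"

lemma pos [simp]: "real n + a > 0"
  using a_pos by (simp add: add_nonneg_pos)

lemma nonzero [simp]: "real n + a \<noteq> 0"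
  using pos[of n] by (metis less_irrefl)

lemma norm_powr: "norm (of_real (real n + a) powr w :: complex) = (real n + a) powr Re w"
  by (subst norm_powr_real_powr) (auto simp: less_imp_le[OF pos] simp del: of_real_add)

lemma series_dominated:
  assumes "Re z > 1"
  shows "\<exists>r>0. cball z r \<subseteq> {s. Re s > 1} \<and> (\<exists>M. summable M \<and>
    (\<forall>\<^sub>F n in sequentially. \<forall>w\<in>cball z r. norm (c n * of_real (real n + a) powr (-w)) \<le> M n))"
proof -
  \<comment> \<open>With a third of the distance to the line Re s = 1, every point of the ball keeps
    a margin of at least \<open>2 * r\<close>, as \<open>dominated\<close> requires.\<close>
  define r where "r = (Re z - 1) / 3"
  have r: "r > 0" using assms by (simp add: r_def)
  have Re: "Re w \<ge> 1 + 2 * r" if "w \<in> cball z r" for w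
    using that abs_Re_le_cmod[of "z - w"] by (simp add: r_def dist_norm) (simp add: field_simps)
  have ge: "\<forall>\<^sub>F n in sequentially. real n \<ge> 1"
    by real_asymp
  have "\<exists>M. summable M \<and>
    (\<forall>\<^sub>F n in sequentially. \<forall>w\<in>cball z r. norm (c n * of_real (real n + a) powr (-w)) \<le> M n)"
  proof (rule dominated[OF r, of 1])
    show "\<forall>\<^sub>F n in sequentially. \<forall>w\<in>cball z r. norm (c n * of_real (real n + a) powr (-w))
        \<le> norm (c n) * (1 * (real n + a) powr (-1 - 2 * r))"
      using ge
    proof eventually_elim
      case (elim n)
      thus ?case using Re a_pos
        by (auto simp: norm_mult norm_powr simp del: of_real_add intro!: mult_left_mono powr_mono)
           fastforce
    qed
  qed simp
  moreover have "cball z r \<subseteq> {s. Re s > 1}" using Re r by fastforce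
  ultimately show ?thesis using r by blast
qed

lemma powr_holomorphic:
  assumes "f holomorphic_on A"
  shows "(\<lambda>s. of_real (real n + a) powr f s :: complex) holomorphic_on A"
  using pos[of n] assms by (auto intro!: holomorphic_intros simp flip: of_real_add simp del: pos)

lemma series_holomorphic: "series holomorphic_on {s. Re s > 1}"
  unfolding series_def
  by (rule holomorphic_suminf_locally_dominated[OF _ _ series_dominated])
     (auto intro!: holomorphic_intros powr_holomorphic open_halfspace_Re_gt simp del: of_real_add)

lemma series_sums:
  assumes "Re s > 1"
  shows "(\<lambda>n. c n * of_real (real n + a) powr (-s)) sums series s"
  unfolding series_def
  by (rule summable_sums, rule holomorphic_suminf_locally_dominated(2)[OF _ _ series_dominated, of s])
     (use assms in \<open>auto intro!: holomorphic_intros powr_holomorphic open_halfspace_Re_gt simp del: of_real_add\<close>)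

end

subsection \<open>The expansion at the pole\<close>

text \<open>Substituting \<open>v = w * ln u\<close> turns the integral of
  \<open>u powr (w - 1) * ln u ^ (j - 1)\<close> over [1, t] into this function, which remains
  meaningful at \<open>w = 0\<close>. The proof is the product rule followed by the differential
  equation of \<open>exp_primitive\<close>.\<close>

lemma has_field_derivative_Ln_exp_primitive:
  assumes j: "j > 0" and t: "t \<notin> \<real>\<^sub>\<le>\<^sub>0"
  shows "((\<lambda>t. Ln t ^ j * exp_primitive j (w * Ln t)) has_field_derivative
           t powr (w - 1) * Ln t ^ (j - 1)) (at t within A)"
proof -
  have t0: "t \<noteq> 0" using t by auto
  define L where "L = Ln t"
  define E' where "E' = eval_fps (fps_deriv (exp_primitive_fps j)) (w * L)"
  obtain k where k: "j = Suc k" using j by (cases j) auto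
  have "((\<lambda>t. Ln t ^ j * exp_primitive j (w * Ln t)) has_field_derivative
      (of_nat j * (L ^ (j - 1) * inverse t)) * exp_primitive j (w * L)
        + L ^ j * (E' * (w * inverse t))) (at t within A)"
    unfolding L_def E'_def using t
    by (auto intro!: derivative_eq_intros DERIV_chain2[OF has_field_derivative_exp_primitive])
  also have "(of_nat j * (L ^ (j - 1) * inverse t)) * exp_primitive j (w * L)
        + L ^ j * (E' * (w * inverse t))
      = L ^ (j - 1) * inverse t * (of_nat j * exp_primitive j (w * L) + w * L * E')"
    by (simp add: k algebra_simps)
  also have "\<dots> = t powr (w - 1) * L ^ (j - 1)"
    unfolding E'_def exp_primitive_deriv[OF j] using t0
    by (simp add: powr_def exp_diff L_def algebra_simps divide_simps)
  finally show ?thesis by (simp add: L_def)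
qed

lemma exp_primitive_holomorphic [holomorphic_intros]:
  assumes "f holomorphic_on A"
  shows "(\<lambda>w. exp_primitive j (f w)) holomorphic_on A"
proof -
  have "exp_primitive j holomorphic_on f ` A"
    unfolding holomorphic_on_def field_differentiable_def
    using has_field_derivative_exp_primitive by blast
  thus ?thesis using holomorphic_on_compose[OF assms] by (simp add: o_def)
qed

text \<open>The coefficient of \<open>w ^ m\<close> is
  \<open>L ^ (m + j) / (fact m * (m + j))\<close>. For \<open>j = 2\<close> and \<open>j = 1\<close>
  this produces the two logarithmic terms subtracted in \<open>gamma_H_approx\<close>.\<close>

lemma deriv_exp_primitive_scaled:
  "(deriv ^^ m) (\<lambda>w. L ^ j * exp_primitive j (w * L)) 0 = L ^ (m + j) / of_nat (m + j)"
proof -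
  have "exp_primitive j has_fps_expansion exp_primitive_fps j"
    unfolding exp_primitive_def by (rule eval_fps_has_fps_expansion) simp
  hence "(exp_primitive j \<circ> (\<lambda>w. L * w)) has_fps_expansion fps_compose (exp_primitive_fps j) (fps_const L * fps_X)"
    by (intro has_fps_expansion_compose fps_expansion_intros) auto
  hence "(\<lambda>w. L ^ j * exp_primitive j (w * L)) has_fps_expansion
      fps_const (L ^ j) * fps_compose (exp_primitive_fps j) (fps_const L * fps_X)"
    by (intro fps_expansion_intros) (simp add: o_def mult.commute)
  hence "fps_nth (fps_const (L ^ j) * fps_compose (exp_primitive_fps j) (fps_const L * fps_X)) m
      = (deriv ^^ m) (\<lambda>w. L ^ j * exp_primitive j (w * L)) 0 / fact m"
    by (rule fps_nth_fps_expansion)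
  hence "L ^ j * (L ^ m * (1 / (fact m * of_nat (m + j)))) = (deriv ^^ m) (\<lambda>w. L ^ j * exp_primitive j (w * L)) 0 / fact m"
    by (simp add: exp_primitive_fps_def)
  thus ?thesis
    by (simp add: power_add divide_simps mult_ac split: if_splits)
qed

lemma deriv_exp_scaled:
  "(deriv ^^ m) (\<lambda>w. k * exp (w * L)) 0 = (k * L ^ m :: complex)"
proof -
  have "(deriv ^^ m) (\<lambda>w. k * exp (w * L)) = (\<lambda>w. k * L ^ m * exp (w * L))"
  proof (induction m)
    case (Suc m)
    have "deriv (\<lambda>w. k * L ^ m * exp (w * L)) w = k * L ^ Suc m * exp (w * L)" for w
      by (rule DERIV_imp_deriv) (auto intro!: derivative_eq_intros)
    thus ?case by (simp add: Suc.IH)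
  qed simp
  thus ?thesis by simp
qed

section \<open>Partial sums compared with the integral\<close>

context logarithmic_coefficients
begin

text \<open>
  With \<open>w = 1 - s\<close>, this is the integral of \<open>u powr (w - 1) * (\<alpha> * ln u + \<beta>)\<close> over \<open>[1, t]\<close>,
  in a form that makes sense at \<open>w = 0\<close>.
\<close>

definition main_primitive :: "complex \<Rightarrow> complex \<Rightarrow> complex" where
  "main_primitive w t = \<alpha> * (Ln t ^ 2 * exp_primitive 2 (w * Ln t)) + \<beta> * (Ln t ^ 1 * exp_primitive 1 (w * Ln t))"

text \<open>The \<open>n\<close>-th term minus the integral over [n - 1 + a, n + a]. For
  \<open>n = 0\<close> the integral starts at 1, where \<open>main_primitive\<close> vanishes, so
  partial sums telescope to the sum minus the integral from 1 to N + a.\<close>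

definition increment :: "nat \<Rightarrow> complex \<Rightarrow> complex" where
  "increment n w = c n * of_real (real n + a) powr (w - 1)
     - (main_primitive w (of_real (real n + a))
        - (if n = 0 then 0 else main_primitive w (of_real (real (n - 1) + a))))"

lemma sum_increment:
  "(\<Sum>n<Suc N. increment n w) = (\<Sum>n\<le>N. c n * of_real (real n + a) powr (w - 1))
     - main_primitive w (of_real (real N + a))"
  by (induction N) (auto simp: increment_def)

lemma has_field_derivative_main_primitive:
  assumes "t \<notin> \<real>\<^sub>\<le>\<^sub>0"
  shows "(main_primitive w has_field_derivative t powr (w - 1) * (\<alpha> * Ln t + \<beta>)) (at t within A)"
proof -
  have "(main_primitive w has_field_derivative
      \<alpha> * (t powr (w - 1) * Ln t ^ (2 - 1)) + \<beta> * (t powr (w - 1) * Ln t ^ (1 - 1))) (at t within A)"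
    unfolding main_primitive_def using assms
    by (intro DERIV_add DERIV_cmult has_field_derivative_Ln_exp_primitive) auto
  thus ?thesis by (simp add: algebra_simps)
qed

lemma increment_holomorphic: "increment n holomorphic_on A"
  unfolding increment_def main_primitive_def
  by (cases "n = 0") (auto intro!: holomorphic_intros powr_holomorphic simp del: of_real_add)

text \<open>Two errors add up: replacing \<open>c n\<close> by its asymptotic value costs the first
  summand, and replacing the integral over a unit interval by the integrand at the right endpoint
  costs a second-order Taylor remainder, the second summand. The condition \<open>n \<ge> 2\<close>
  keeps the interval in [1, \<infinity>), where logarithms are nonnegative and powers increase with
  the exponent.\<close>

lemma norm_increment_le:
  assumes n: "n \<ge> 2" and w: "Re w \<le> 1 - d" "norm w \<le> R" and d: "d > 0"
  defines "y \<equiv> real n + a"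
  shows "norm (increment n w) \<le> C * y powr (-1 - d)
    + (y - 1) powr (-1 - d) * ((R + 1) * (norm \<alpha> * ln y + norm \<beta>) + norm \<alpha>)"
proof -
  \<comment> \<open>For \<open>i \<le> 2\<close> this is the \<open>i\<close>-th derivative of
    \<open>main_primitive w\<close>, arranged for \<open>complex_Taylor\<close>.\<close>
  define f :: "nat \<Rightarrow> complex \<Rightarrow> complex" where "f = (\<lambda>i t.
     if i = 0 then main_primitive w t
     else if i = 1 then t powr (w - 1) * (\<alpha> * Ln t + \<beta>)
     else t powr (w - 2) * ((w - 1) * (\<alpha> * Ln t + \<beta>) + \<alpha>))"
  define B where "B = (y - 1) powr (-1 - d) * ((R + 1) * (norm \<alpha> * ln y + norm \<beta>) + norm \<alpha>)"
  define S where "S = closed_segment (of_real (y - 1)) (of_real y :: complex)"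
  have y: "y \<ge> 2" using n a_pos by (simp add: y_def)
  have S: "\<exists>x. t = of_real x \<and> y - 1 \<le> x \<and> x \<le> y" if "t \<in> S" for t
    using that unfolding S_def closed_segment_of_real by (auto simp: closed_segment_eq_real_ivl)
  have S': "t \<notin> \<real>\<^sub>\<le>\<^sub>0 \<and> t \<noteq> 0" if "t \<in> S" for t
    using S[OF that] y by auto
  have deriv: "(f i has_field_derivative f (Suc i) t) (at t within S)" if t: "t \<in> S" and i: "i \<le> 1" for i t
  proof (cases "i = 0")
    case True
    thus ?thesis using has_field_derivative_main_primitive[of t w S] S'[OF t] by (simp add: f_def)
  next
    case False
    hence [simp]: "i = Suc 0" using i by simp
    have "((\<lambda>t. t powr (w - 1) * (\<alpha> * Ln t + \<beta>)) has_field_derivative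
        t powr (w - 1) * (\<alpha> * inverse t) + (w - 1) * t powr (w - 1 - 1) * (\<alpha> * Ln t + \<beta>)) (at t within S)"
      using S'[OF t] by (auto intro!: derivative_eq_intros simp: algebra_simps)
    also have "t powr (w - 1) * (\<alpha> * inverse t) + (w - 1) * t powr (w - 1 - 1) * (\<alpha> * Ln t + \<beta>)
        = t powr (w - 2) * ((w - 1) * (\<alpha> * Ln t + \<beta>) + \<alpha>)"
    proof -
      have "t powr (w - 1) = t powr (w - 2) * t powr 1"
        by (subst powr_add [symmetric]) simp
      hence e: "t powr (w - 1) = t powr (w - 2) * t"
        using S'[OF t] by simp
      show ?thesis using S'[OF t] by (simp add: e) (simp add: algebra_simps)
    qed
    finally show ?thesis by (simp add: f_def)
  qed
  have bound: "norm (f 2 t) \<le> B" if t: "t \<in> S" for t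
  proof -
    obtain x where x: "t = of_real x" "y - 1 \<le> x" "x \<le> y" using S[OF t] by blast
    have x1: "x \<ge> 1" using x y by simp
    have l: "0 \<le> ln x" "ln x \<le> ln y" using x x1 by auto
    have "norm (t powr (w - 2)) = x powr (Re w - 2)"
      using x1 unfolding x(1) by (subst norm_powr_real_powr) auto
    also have "\<dots> \<le> x powr (-1 - d)" using x1 w by (intro powr_mono) auto
    also have "\<dots> \<le> (y - 1) powr (-1 - d)" using x y d by (intro powr_mono2') auto
    finally have 1: "norm (t powr (w - 2)) \<le> (y - 1) powr (-1 - d)" .
    have "norm (\<alpha> * Ln t + \<beta>) \<le> norm \<alpha> * norm (Ln t) + norm \<beta>"
      by (metis norm_mult norm_triangle_ineq)
    also have "norm (Ln t) = ln x" using x1 l unfolding x(1) by (simp add: Ln_of_real)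
    also have "norm \<alpha> * ln x + norm \<beta> \<le> norm \<alpha> * ln y + norm \<beta>"
      using l by (intro add_mono mult_left_mono) auto
    finally have 2: "norm (\<alpha> * Ln t + \<beta>) \<le> norm \<alpha> * ln y + norm \<beta>" .
    have 3: "norm (w - 1) \<le> R + 1"
      using w norm_triangle_ineq4[of w 1] by simp
    have "norm ((w - 1) * (\<alpha> * Ln t + \<beta>) + \<alpha>) \<le> norm (w - 1) * norm (\<alpha> * Ln t + \<beta>) + norm \<alpha>"
      by (metis norm_mult norm_triangle_ineq)
    also have "\<dots> \<le> (R + 1) * (norm \<alpha> * ln y + norm \<beta>) + norm \<alpha>"
      using 2 3 by (intro add_mono mult_mono) (auto intro: order_trans[OF norm_ge_zero])
    finally have 4: "norm ((w - 1) * (\<alpha> * Ln t + \<beta>) + \<alpha>) \<le> \<dots>" .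
    show ?thesis unfolding f_def B_def norm_mult using 1 4
      by (auto simp: norm_mult intro!: mult_mono)
  qed
  have "norm (f 0 (of_real (y - 1)) - (\<Sum>i\<le>1. f i (of_real y) * (of_real (y - 1) - of_real y) ^ i / fact i))
      \<le> B * norm (of_real (y - 1) - of_real y :: complex) ^ Suc 1 / fact 1"
    by (rule complex_Taylor[where S = S])
       (use deriv bound in \<open>auto simp: S_def numeral_2_eq_2\<close>)
  hence "norm (main_primitive w (of_real (y - 1)) - (main_primitive w (of_real y)
      - of_real y powr (w - 1) * (\<alpha> * Ln (of_real y) + \<beta>))) \<le> B"
    by (simp add: f_def norm_minus_commute)
  moreover have "norm (of_real y powr (w - 1) * (c n - (\<alpha> * Ln (of_real y) + \<beta>))) \<le> C * y powr (-1 - d)"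
  proof -
    have "norm (of_real y powr (w - 1) :: complex) = y powr (Re w - 1)"
      using norm_powr[of n "w - 1"] by (simp add: y_def)
    also have "\<dots> \<le> y powr (-d)" using w y by (intro powr_mono) auto
    finally have "norm (of_real y powr (w - 1) :: complex) * norm (c n - (\<alpha> * Ln (of_real y) + \<beta>))
        \<le> y powr (-d) * (C / y)"
      using coeff_asymp[of n] y by (intro mult_mono) (auto simp: y_def Ln_of_real simp flip: of_real_add)
    also have "\<dots> = C * y powr (-1 - d)"
      using y powr_add[of y "-1" "-d"] by (simp add: powr_minus_divide)
    finally show ?thesis by (simp add: norm_mult)
  qed
  moreover have "increment n w = of_real y powr (w - 1) * (c n - (\<alpha> * Ln (of_real y) + \<beta>))
     + (main_primitive w (of_real (y - 1)) - (main_primitive w (of_real y)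
        - of_real y powr (w - 1) * (\<alpha> * Ln (of_real y) + \<beta>)))"
    using n by (simp add: increment_def y_def of_nat_diff algebra_simps)
  ultimately show ?thesis
    unfolding B_def by (metis norm_triangle_mono)
qed

lemma increment_dominated:
  assumes "Re z < 1"
  shows "\<exists>r>0. cball z r \<subseteq> {w. Re w < 1} \<and> (\<exists>M. summable M \<and>
    (\<forall>\<^sub>F n in sequentially. \<forall>w\<in>cball z r. norm (increment n w) \<le> M n))"
proof -
  \<comment> \<open>Half the distance to the line Re w = 1: the ball of radius \<open>d\<close>
    around \<open>z\<close> stays at distance at least \<open>d\<close> from it.\<close>
  define d where "d = (1 - Re z) / 2"
  have d: "d > 0" using assms by (simp add: d_def)
  define R where "R = norm z + d"
  have w: "Re w \<le> 1 - d" "norm w \<le> R" if "w \<in> cball z d" for w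
    using that abs_Re_le_cmod[of "z - w"] norm_triangle_ineq2[of w z]
    by (auto simp: d_def R_def dist_norm norm_minus_commute field_simps)
  define P where "P = (R + 1) * norm \<alpha> + 1"
  define Q where "Q = (R + 1) * norm \<beta> + norm \<alpha>"
  have P: "P > 0" using d by (simp add: P_def R_def add_nonneg_pos)
  define M where "M = (\<lambda>n. C * (real n + a) powr (-1 - d)
     + (real n + a - 1) powr (-1 - d) * (P * ln (real n + a) + Q))"
  have "summable (\<lambda>n. (real n + a - 1) powr (-1 - d) * (P * ln (real n + a) + Q))"
  proof (rule summable_comparison_test_bigo)
    \<comment> \<open>Half of the margin \<open>d\<close> is given up to absorb the
      logarithm.\<close>
    show "summable (\<lambda>n. norm (real n powr (-1 - d / 2)))"
      using d by (simp add: summable_real_powr_iff)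
    show "(\<lambda>n. (real n + a - 1) powr (-1 - d) * (P * ln (real n + a) + Q)) \<in> O(\<lambda>n. real n powr (-1 - d / 2))"
      using P d by real_asymp
  qed
  hence M: "summable M"
    unfolding M_def using summable_shifted_powr[OF d] by (intro summable_add summable_mult)
  have "\<forall>\<^sub>F n in sequentially. \<forall>w\<in>cball z d. norm (increment n w) \<le> M n"
    using eventually_ge_at_top[of 2]
  proof eventually_elim
    case (elim n)
    have "ln (real n + a) \<ge> 0" using elim a_pos by simp
    hence "(real n + a - 1) powr (-1 - d) * ((R + 1) * (norm \<alpha> * ln (real n + a) + norm \<beta>) + norm \<alpha>)
      \<le> (real n + a - 1) powr (-1 - d) * (P * ln (real n + a) + Q)"
      by (intro mult_left_mono) (auto simp: P_def Q_def algebra_simps)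
    thus ?case unfolding M_def using norm_increment_le[OF elim w d] by fastforce
  qed
  moreover have "cball z d \<subseteq> {w. Re w < 1}" using w d by fastforce
  ultimately show ?thesis using d M by blast
qed

text \<open>In the variable \<open>w = 1 - s\<close>, this is what remains of the series at
  \<open>s = 1\<close> after removal of the polar part. It converges for Re w < 1, that is, for Re s
  > 0.\<close>

definition regular_part :: "complex \<Rightarrow> complex" where
  "regular_part w = (\<Sum>n. increment n w)"

lemma regular_part_holomorphic: "regular_part holomorphic_on {w. Re w < 1}"
  unfolding regular_part_def
  by (rule holomorphic_suminf_locally_dominated[OF _ _ increment_dominated])
     (auto intro!: increment_holomorphic open_halfspace_Re_lt)

lemma regular_part_sums: "Re w < 1 \<Longrightarrow> (\<lambda>n. increment n w) sums regular_part w"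
  unfolding regular_part_def
  by (rule summable_sums, rule holomorphic_suminf_locally_dominated(2)[OF _ _ increment_dominated, of w])
     (auto intro!: increment_holomorphic open_halfspace_Re_lt)

text \<open>For Re w < 0 the sum and the integral converge separately. The closed forms of
  \<open>exp_primitive\<close> give the integral over [1, \<infinity>) as
  \<open>\<alpha> / w\<^sup>2 - \<beta> / w\<close>, since \<open>exp (w * L N)\<close> and
  \<open>L N * exp (w * L N)\<close> tend to 0.\<close>

lemma regular_part_eq_series:
  assumes w: "Re w < 0"
  shows "regular_part w = series (1 - w) - \<alpha> / w\<^sup>2 + \<beta> / w"
proof -
  have w0: "w \<noteq> 0" using w by auto
  define L where "L = (\<lambda>N. of_real (ln (real N + a)) :: complex)"
  have L: "Ln (of_real (real N + a)) = L N" for N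
    unfolding L_def by (rule Ln_of_real) (rule pos)
  have lim1: "(\<lambda>N. exp (w * L N)) \<longlonglongrightarrow> 0"
  proof (rule tendsto_norm_zero_cancel)
    have "(\<lambda>N. exp (Re w * ln (real N + a))) \<longlonglongrightarrow> 0"
      using w by real_asymp
    thus "(\<lambda>N. norm (exp (w * L N))) \<longlonglongrightarrow> 0" by (simp add: L_def)
  qed
  have lim2: "(\<lambda>N. L N * exp (w * L N)) \<longlonglongrightarrow> 0"
  proof (rule tendsto_norm_zero_cancel)
    have "(\<lambda>N. \<bar>ln (real N + a)\<bar> * exp (Re w * ln (real N + a))) \<longlonglongrightarrow> 0"
      using w by real_asymp
    thus "(\<lambda>N. norm (L N * exp (w * L N))) \<longlonglongrightarrow> 0" by (simp add: L_def norm_mult)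
  qed
  have G: "main_primitive w (of_real (real N + a)) =
     \<alpha> * (w * (L N * exp (w * L N)) - exp (w * L N) + 1) / w\<^sup>2 + \<beta> * (exp (w * L N) - 1) / w" for N
  proof -
    have "L N * exp_primitive 1 (w * L N) = (exp (w * L N) - 1) / w"
      using exp_primitive_1[of "w * L N"] w0 by (simp add: eq_divide_eq mult_ac)
    moreover have "L N ^ 2 * exp_primitive 2 (w * L N)
        = (w * (L N * exp (w * L N)) - exp (w * L N) + 1) / w\<^sup>2"
      using exp_primitive_2[of "w * L N"] w0 by (simp add: eq_divide_eq power_mult_distrib mult_ac)
    ultimately show ?thesis
      unfolding main_primitive_def L power_one_right times_divide_eq_right [symmetric] by simp
  qed
  have limG: "(\<lambda>N. main_primitive w (of_real (real N + a))) \<longlonglongrightarrow>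
     \<alpha> * (w * 0 - 0 + 1) / w\<^sup>2 + \<beta> * (0 - 1) / w"
    unfolding G by (intro tendsto_intros lim1 lim2) (use w0 in auto)
  have "(\<lambda>n. c n * of_real (real n + a) powr (w - 1)) sums series (1 - w)"
    using series_sums[of "1 - w"] w by simp
  hence "(\<lambda>N. \<Sum>n\<le>N. c n * of_real (real n + a) powr (w - 1)) \<longlonglongrightarrow> series (1 - w)"
    by (simp add: sums_def_le)
  hence "(\<lambda>N. \<Sum>n<Suc N. increment n w) \<longlonglongrightarrow>
      series (1 - w) - (\<alpha> * (w * 0 - 0 + 1) / w\<^sup>2 + \<beta> * (0 - 1) / w)"
    unfolding sum_increment by (intro tendsto_diff limG)
  moreover have "(\<lambda>N. \<Sum>n<Suc N. increment n w) \<longlonglongrightarrow> regular_part w"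
    using regular_part_sums[of w] w unfolding sums_def by (intro LIMSEQ_Suc) auto
  ultimately have "regular_part w = series (1 - w) - (\<alpha> * (w * 0 - 0 + 1) / w\<^sup>2 + \<beta> * (0 - 1) / w)"
    using LIMSEQ_unique by blast
  thus ?thesis by simp
qed

text \<open>Uniform convergence near \<open>w = 0\<close> carries over to the \<open>m\<close>-th
  derivatives at 0, and the \<open>m\<close>-th derivative of a partial sum is exactly the displayed
  expression.\<close>

lemma regular_part_coefficient_limit:
  "(\<lambda>N. (\<Sum>n\<le>N. c n * of_real (ln (real n + a)) ^ m / of_real (real n + a))
      - \<alpha> * of_real (ln (real N + a)) ^ (m + 2) / of_nat (m + 2)
      - \<beta> * of_real (ln (real N + a)) ^ (m + 1) / of_nat (m + 1))
    \<longlonglongrightarrow> (deriv ^^ m) regular_part 0"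
proof -
  obtain r where r: "r > 0" "uniform_limit (cball 0 r) (\<lambda>n w. \<Sum>i<n. increment i w) regular_part sequentially"
    using holomorphic_suminf_locally_dominated(3)[of "{w. Re w < 1}" increment 0]
      increment_dominated increment_holomorphic open_halfspace_Re_lt[of 1]
    unfolding regular_part_def by auto
  have "(\<lambda>N. (deriv ^^ m) (\<lambda>w. \<Sum>n<N. increment n w) 0) \<longlonglongrightarrow> (deriv ^^ m) regular_part 0"
    by (rule higher_deriv_complex_uniform_limit[where A = "ball 0 r"])
       (use r in \<open>auto intro!: always_eventually holomorphic_intros increment_holomorphic uniform_limit_on_subset[OF r(2)]\<close>)
  hence lim: "(\<lambda>N. (deriv ^^ m) (\<lambda>w. \<Sum>n<Suc N. increment n w) 0) \<longlonglongrightarrow> (deriv ^^ m) regular_part 0"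
    by (rule LIMSEQ_Suc)
  have Ln: "Ln (of_real (real N + a)) = of_real (ln (real N + a))" for N
    by (rule Ln_of_real) (rule pos)
  have "(deriv ^^ m) (\<lambda>w. \<Sum>n<Suc N. increment n w) 0 =
     (\<Sum>n\<le>N. c n * of_real (ln (real n + a)) ^ m / of_real (real n + a))
      - \<alpha> * of_real (ln (real N + a)) ^ (m + 2) / of_nat (m + 2)
      - \<beta> * of_real (ln (real N + a)) ^ (m + 1) / of_nat (m + 1)" for N
  proof -
    define L where "L = (\<lambda>N. of_real (ln (real N + a)) :: complex)"
    \<comment> \<open>Written as an exponential in \<open>w\<close>, each term gains a factor
      \<open>L n\<close> with every differentiation.\<close>
    have p: "c n * of_real (real n + a) powr (w - 1) = c n / of_real (real n + a) * exp (w * L n)" for n w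
    proof -
      have "exp (L n) = of_real (real n + a)"
        unfolding L_def exp_of_real using pos[of n] by simp
      moreover have "of_real (real n + a) powr (w - 1) = exp ((w - 1) * L n)"
        using pos[of n] Ln[of n] by (simp add: powr_def L_def del: of_real_add)
      ultimately show ?thesis by (simp add: left_diff_distrib exp_diff del: of_real_add)
    qed
    have expand: "(\<lambda>w. \<Sum>n<Suc N. increment n w) = (\<lambda>w. (\<Sum>n\<le>N. c n / of_real (real n + a) * exp (w * L n))
      - \<alpha> * (L N ^ 2 * exp_primitive 2 (w * L N)) - \<beta> * (L N ^ 1 * exp_primitive 1 (w * L N)))"
      unfolding sum_increment main_primitive_def Ln p by (simp add: L_def diff_diff_add)
    have "(deriv ^^ m) (\<lambda>w. \<Sum>n<Suc N. increment n w) 0 =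
       (\<Sum>n\<le>N. (deriv ^^ m) (\<lambda>w. c n / of_real (real n + a) * exp (w * L n)) 0)
       - \<alpha> * (deriv ^^ m) (\<lambda>w. L N ^ 2 * exp_primitive 2 (w * L N)) 0
       - \<beta> * (deriv ^^ m) (\<lambda>w. L N ^ 1 * exp_primitive 1 (w * L N)) 0"
    proof -
      have s: "(deriv ^^ m) (\<lambda>w. \<Sum>n\<in>A. c n / of_real (real n + a) * exp (w * L n)) 0
         = (\<Sum>n\<in>A. (deriv ^^ m) (\<lambda>w. c n / of_real (real n + a) * exp (w * L n)) 0)"
        if "finite A" for A
        using that
      proof induction
        case empty
        show ?case by (induction m) auto
      next
        case (insert x F)
        thus ?case
          by (simp only: sum.insert simp_thms)
             (subst higher_deriv_add[where S = UNIV], auto intro!: holomorphic_intros)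
      qed
      define f g h where "f = (\<lambda>w. \<Sum>n\<le>N. c n / of_real (real n + a) * exp (w * L n))"
        and "g = (\<lambda>w. L N ^ 2 * exp_primitive 2 (w * L N))"
        and "h = (\<lambda>w. L N ^ 1 * exp_primitive 1 (w * L N))"
      have hol: "f holomorphic_on UNIV" "g holomorphic_on UNIV" "h holomorphic_on UNIV"
        unfolding f_def g_def h_def by (auto intro!: holomorphic_intros)
      have "(deriv ^^ m) (\<lambda>w. f w - \<alpha> * g w - \<beta> * h w) 0
          = (deriv ^^ m) (\<lambda>w. f w - \<alpha> * g w) 0 - (deriv ^^ m) (\<lambda>w. \<beta> * h w) 0"
        by (rule higher_deriv_diff[where S = UNIV]) (auto intro!: holomorphic_intros hol)
      also have "(deriv ^^ m) (\<lambda>w. f w - \<alpha> * g w) 0 = (deriv ^^ m) f 0 - (deriv ^^ m) (\<lambda>w. \<alpha> * g w) 0"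
        by (rule higher_deriv_diff[where S = UNIV]) (auto intro!: holomorphic_intros hol)
      finally show ?thesis
        unfolding expand
        using higher_deriv_cmult[OF hol(2) UNIV_I open_UNIV, of m \<alpha> 0]
          higher_deriv_cmult[OF hol(3) UNIV_I open_UNIV, of m \<beta> 0] s[of "{..N}"]
        unfolding f_def g_def h_def by (simp only: finite_atMost simp_thms)
    qed
    thus ?thesis
      unfolding deriv_exp_primitive_scaled deriv_exp_scaled L_def
      by (simp only: times_divide_eq_right times_divide_eq_left)
  qed
  from lim[unfolded this] show ?thesis .
qed

end

subsection \<open>Continuation to the whole plane\<close>

text \<open>The factor in the \<open>i\<close>-th derivative of \<open>t powr z\<close>; divided by
  \<open>fact i\<close> it is the binomial coefficient z over i.\<close>

definition falling_factorial :: "nat \<Rightarrow> complex \<Rightarrow> complex" where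
  "falling_factorial i z = (\<Prod>j<i. z - of_nat j)"

lemma falling_factorial_holomorphic [holomorphic_intros]:
  "f holomorphic_on A \<Longrightarrow> (\<lambda>s. falling_factorial i (f s)) holomorphic_on A"
  unfolding falling_factorial_def by (intro holomorphic_intros)

context logarithmic_coefficients
begin

text \<open>\<open>c n\<close> times the error of the Taylor polynomial of degree \<open>K\<close>
  for \<open>t powr (1 - s)\<close>, expanded at \<open>n + a\<close> and evaluated one unit further
  right.\<close>

definition taylor_remainder :: "nat \<Rightarrow> nat \<Rightarrow> complex \<Rightarrow> complex" where
  "taylor_remainder K n s = c n * (of_real (real (Suc n) + a) powr (1 - s)
     - (\<Sum>i\<le>K. falling_factorial i (1 - s) / fact i * of_real (real n + a) powr (1 - s - of_nat i)))"

lemma taylor_remainder_holomorphic: "taylor_remainder K n holomorphic_on A"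
  unfolding taylor_remainder_def
  by (auto intro!: holomorphic_intros powr_holomorphic simp del: of_nat_Suc of_real_add)

text \<open>The derivative of order \<open>K + 1\<close> carries the power
  \<open>1 - s - (K + 1)\<close>, whose real part is \<open>- Re s - K\<close>. Each further Taylor
  term therefore moves the region of convergence one unit to the left.\<close>

lemma norm_taylor_remainder_le:
  assumes n: "n \<ge> 1" and s: "Re s + real K \<ge> 1 + 2 * d" and d: "d > 0"
  shows "norm (taylor_remainder K n s)
    \<le> norm (c n) * (norm (falling_factorial (Suc K) (1 - s)) * (real n + a) powr (-1 - 2 * d))"
proof -
  define y where "y = real n + a"
  define f where "f = (\<lambda>i t. falling_factorial i (1 - s) * t powr (1 - s - of_nat i))"
  define S where "S = closed_segment (of_real y) (of_real (y + 1) :: complex)"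
  define B where "B = norm (falling_factorial (Suc K) (1 - s)) * y powr (-1 - 2 * d)"
  have y: "y \<ge> 1" using n a_pos by (simp add: y_def)
  have S: "\<exists>x. t = of_real x \<and> y \<le> x \<and> x \<le> y + 1" if "t \<in> S" for t
    using that unfolding S_def closed_segment_of_real by (auto simp: closed_segment_eq_real_ivl)
  have deriv: "(f i has_field_derivative f (Suc i) t) (at t within S)" if t: "t \<in> S" for i t
  proof -
    have "t \<notin> \<real>\<^sub>\<le>\<^sub>0" using S[OF t] y by auto
    hence "((\<lambda>t. falling_factorial i (1 - s) * t powr (1 - s - of_nat i)) has_field_derivative
      falling_factorial i (1 - s) * ((1 - s - of_nat i) * t powr (1 - s - of_nat i - 1))) (at t within S)"
      by (auto intro!: derivative_eq_intros)
    thus ?thesis by (simp add: f_def falling_factorial_def algebra_simps)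
  qed
  have bound: "norm (f (Suc K) t) \<le> B" if t: "t \<in> S" for t
  proof -
    obtain x where x: "t = of_real x" "y \<le> x" using S[OF t] by blast
    have "norm (t powr (1 - s - of_nat (Suc K))) = x powr (Re (1 - s - of_nat (Suc K)))"
      using x y unfolding x(1) by (subst norm_powr_real_powr) auto
    also have "\<dots> \<le> x powr (-1 - 2 * d)" using x y s by (intro powr_mono) auto
    also have "\<dots> \<le> y powr (-1 - 2 * d)" using x y d by (intro powr_mono2') auto
    finally show ?thesis
      unfolding f_def B_def norm_mult by (intro mult_left_mono) auto
  qed
  have "norm (f 0 (of_real (y + 1)) - (\<Sum>i\<le>K. f i (of_real y) * (of_real (y + 1) - of_real y) ^ i / fact i))
      \<le> B * norm (of_real (y + 1) - of_real y :: complex) ^ Suc K / fact K"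
    by (rule complex_Taylor[where S = S])
       (use deriv bound in \<open>auto simp: S_def\<close>)
  also have "\<dots> \<le> B"
  proof -
    have "B * 1 \<le> B * fact K"
      by (intro mult_left_mono) (auto simp: B_def fact_ge_1)
    thus ?thesis by (simp add: divide_le_eq)
  qed
  finally have "norm (f 0 (of_real (y + 1)) - (\<Sum>i\<le>K. f i (of_real y) / fact i)) \<le> B"
    by simp
  hence "norm (c n) * norm (f 0 (of_real (y + 1)) - (\<Sum>i\<le>K. f i (of_real y) / fact i)) \<le> norm (c n) * B"
    by (intro mult_left_mono) auto
  thus ?thesis
    by (simp add: taylor_remainder_def norm_mult f_def B_def y_def falling_factorial_def[of 0] add_ac)
qed

lemma taylor_remainder_dominated:
  assumes "Re z > 1 - real K"
  shows "\<exists>r>0. cball z r \<subseteq> {s. Re s > 1 - real K} \<and> (\<exists>M. summable M \<and>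
    (\<forall>\<^sub>F n in sequentially. \<forall>w\<in>cball z r. norm (taylor_remainder K n w) \<le> M n))"
proof -
  define r where "r = (Re z + real K - 1) / 3"
  have r: "r > 0" using assms by (simp add: r_def)
  have Re: "Re w + real K \<ge> 1 + 2 * r" if "w \<in> cball z r" for w
    using that abs_Re_le_cmod[of "z - w"] by (simp add: r_def dist_norm) (simp add: field_simps)
  \<comment> \<open>The remaining dependence on \<open>s\<close> is a polynomial, bounded on the
    compact ball.\<close>
  have "continuous_on (cball z r) (\<lambda>s. falling_factorial (Suc K) (1 - s))"
    by (intro holomorphic_on_imp_continuous_on holomorphic_intros)
  hence "bounded ((\<lambda>s. falling_factorial (Suc K) (1 - s)) ` cball z r)"
    by (intro compact_imp_bounded compact_continuous_image) auto
  then obtain B where B: "B > 0" "\<And>s. s \<in> cball z r \<Longrightarrow> norm (falling_factorial (Suc K) (1 - s)) \<le> B"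
    unfolding bounded_pos by blast
  have "\<exists>M. summable M \<and>
    (\<forall>\<^sub>F n in sequentially. \<forall>w\<in>cball z r. norm (taylor_remainder K n w) \<le> M n)"
  proof (rule dominated[OF r, of B])
    show "\<forall>\<^sub>F n in sequentially. \<forall>w\<in>cball z r. norm (taylor_remainder K n w)
        \<le> norm (c n) * (B * (real n + a) powr (-1 - 2 * r))"
      using eventually_ge_at_top[of 1]
    proof eventually_elim
      case (elim n)
      show ?case
      proof
        fix w assume w: "w \<in> cball z r"
        have "norm (taylor_remainder K n w)
          \<le> norm (c n) * (norm (falling_factorial (Suc K) (1 - w)) * (real n + a) powr (-1 - 2 * r))"
          using norm_taylor_remainder_le[OF elim Re[OF w] r] .
        also have "\<dots> \<le> norm (c n) * (B * (real n + a) powr (-1 - 2 * r))"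
          using B(2)[OF w] by (intro mult_left_mono mult_right_mono) auto
        finally show "norm (taylor_remainder K n w) \<le> norm (c n) * (B * (real n + a) powr (-1 - 2 * r))" .
      qed
    qed
  qed (use B in auto)
  moreover have "cball z r \<subseteq> {s. Re s > 1 - real K}" using Re r by fastforce
  ultimately show ?thesis using r by blast
qed

definition remainder_series :: "nat \<Rightarrow> complex \<Rightarrow> complex" where
  "remainder_series K s = (\<Sum>n. taylor_remainder K n s)"

lemma remainder_series_holomorphic: "remainder_series K holomorphic_on {s. Re s > 1 - real K}"
  unfolding remainder_series_def
  by (rule holomorphic_suminf_locally_dominated[OF _ _ taylor_remainder_dominated])
     (auto intro!: taylor_remainder_holomorphic open_halfspace_Re_gt)

lemma remainder_series_sums:
  "Re s > 1 - real K \<Longrightarrow> (\<lambda>n. taylor_remainder K n s) sums remainder_series K s"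
  unfolding remainder_series_def
  by (rule summable_sums,
      rule holomorphic_suminf_locally_dominated(2)[where S = "{s. Re s > 1 - real K}"])
     (use taylor_remainder_dominated in \<open>auto intro!: taylor_remainder_holomorphic open_halfspace_Re_gt\<close>)

text \<open>Sum the Taylor expansion over \<open>n\<close>. The term \<open>i = 0\<close> pairs with
  \<open>(n + 1 + a) powr (1 - s)\<close> to give \<open>T\<close>, the term \<open>i = 1\<close>
  gives \<open>(s - 1) * series s\<close>, and each \<open>i \<ge> 2\<close> gives the series
  shifted to \<open>s + i - 1\<close>.\<close>

lemma series_functional_equation:
  assumes s: "Re s > 1" and K: "K \<ge> 1"
    and T: "(\<lambda>n. c n * (of_real (real n + a) powr (1 - s) - of_real (real (Suc n) + a) powr (1 - s))) sums T"
  shows "(s - 1) * series s = T + remainder_series K s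
     + (\<Sum>i\<in>{2..K}. falling_factorial i (1 - s) / fact i * series (s + of_nat i - 1))"
proof -
  define b where "b = (\<lambda>i. falling_factorial i (1 - s) / fact i)"
  define p where "p = (\<lambda>n. of_real (real n + a) :: complex)"
  have R: "(\<lambda>n. taylor_remainder K n s) sums remainder_series K s"
    using s by (intro remainder_series_sums) (simp add: algebra_simps)
  have "(\<lambda>n. b i * (c n * p n powr (-(s + of_nat i - 1)))) sums (b i * series (s + of_nat i - 1))"
    if "i \<in> {2..K}" for i
    unfolding p_def using that s by (intro sums_mult series_sums) auto
  hence sums: "(\<lambda>n. \<Sum>i\<in>{2..K}. b i * (c n * p n powr (-(s + of_nat i - 1)))) sums
      (\<Sum>i\<in>{2..K}. b i * series (s + of_nat i - 1))"
    by (rule sums_sum)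
  have "(\<lambda>n. (s - 1) * (c n * p n powr (-s))) sums ((s - 1) * series s)"
    unfolding p_def using s by (intro sums_mult series_sums)
  moreover have "(s - 1) * (c n * p n powr (-s)) =
      c n * (p n powr (1 - s) - p (Suc n) powr (1 - s)) + taylor_remainder K n s
      + (\<Sum>i\<in>{2..K}. b i * (c n * p n powr (-(s + of_nat i - 1))))" for n
  proof -
    have "{..K} = insert 0 (insert 1 {2..K})" using K by auto
    hence "(\<Sum>i\<le>K. b i * p n powr (1 - s - of_nat i)) =
       p n powr (1 - s) + (1 - s) * p n powr (-s) + (\<Sum>i\<in>{2..K}. b i * p n powr (1 - s - of_nat i))"
      by (simp add: b_def falling_factorial_def)
    moreover have "c n * (\<Sum>i\<in>{2..K}. b i * p n powr (1 - s - of_nat i))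
       = (\<Sum>i\<in>{2..K}. b i * (c n * p n powr (-(s + of_nat i - 1))))"
      unfolding sum_distrib_left by (intro sum.cong) (auto simp: algebra_simps)
    moreover have "taylor_remainder K n s
        = c n * (p (Suc n) powr (1 - s) - (\<Sum>i\<le>K. b i * p n powr (1 - s - of_nat i)))"
      by (simp only: taylor_remainder_def b_def p_def)
    ultimately have "taylor_remainder K n s = c n * p (Suc n) powr (1 - s) - c n * p n powr (1 - s)
        - (1 - s) * (c n * p n powr (-s)) - (\<Sum>i\<in>{2..K}. b i * (c n * p n powr (-(s + of_nat i - 1))))"
      by (simp only: right_diff_distrib distrib_left diff_diff_add mult.left_commute)
    thus ?thesis by (simp add: left_diff_distrib right_diff_distrib)
  qed
  ultimately have "(\<lambda>n. c n * (p n powr (1 - s) - p (Suc n) powr (1 - s)) + taylor_remainder K n s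
      + (\<Sum>i\<in>{2..K}. b i * (c n * p n powr (-(s + of_nat i - 1))))) sums ((s - 1) * series s)"
    by simp
  moreover have "(\<lambda>n. c n * (p n powr (1 - s) - p (Suc n) powr (1 - s)) + taylor_remainder K n s
      + (\<Sum>i\<in>{2..K}. b i * (c n * p n powr (-(s + of_nat i - 1))))) sums
      (T + remainder_series K s + (\<Sum>i\<in>{2..K}. b i * series (s + of_nat i - 1)))"
    using T R sums unfolding p_def by (intro sums_add)
  ultimately show ?thesis
    unfolding b_def by (rule sums_unique2)
qed

text \<open>Induction on the half planes: the functional equation extends the series by one unit,
  because its shifts by at least 1 lie in the half plane already reached.\<close>

lemma series_meromorphic_continuation:
  assumes T: "T meromorphic_on UNIV"
    and sums: "\<And>s. Re s > 1 \<Longrightarrow> (\<lambda>n. c n * (of_real (real n + a) powr (1 - s)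
      - of_real (real (Suc n) + a) powr (1 - s))) sums T s"
  shows "\<exists>g. g nicely_meromorphic_on UNIV \<and> (\<forall>s\<in>{s. Re s > 1}. g s = series s)"
proof (rule nicely_meromorphic_glue_half_planes[OF _ series_holomorphic])
  fix K :: nat
  show "\<exists>g. g meromorphic_on {s. Re s > 1 - real K} \<and> (\<forall>s. Re s > 1 \<longrightarrow> g s = series s)"
  proof (induction K)
    case 0
    have "series analytic_on {s. Re s > 1}"
      using series_holomorphic open_halfspace_Re_gt[of 1] by (simp add: analytic_on_open)
    hence "series meromorphic_on {s. Re s > 1}"
      by (rule analytic_on_imp_meromorphic_on)
    thus ?case by auto
  next
    case (Suc K)
    define H where "H = {s. Re s > 1 - real (Suc K)}"
    obtain g where g: "g meromorphic_on {s. Re s > 1 - real K}" "\<And>s. Re s > 1 \<Longrightarrow> g s = series s"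
      using Suc.IH by blast
    \<comment> \<open>The functional equation solved for the series, with the continuation
      \<open>g\<close> in place of the shifted series.\<close>
    define h where "h = (\<lambda>s. (T s + remainder_series (Suc K) s
     + (\<Sum>i\<in>{2..Suc K}. falling_factorial i (1 - s) / fact i * g (s + of_nat i - 1))) / (s - 1))"
    have R: "remainder_series (Suc K) meromorphic_on H"
      using remainder_series_holomorphic[of "Suc K"] open_halfspace_Re_gt[of "1 - real (Suc K)"]
      unfolding H_def by (intro analytic_on_imp_meromorphic_on) (simp add: analytic_on_open del: of_nat_Suc)
    have G: "(\<lambda>s. g (s + of_nat i - 1)) meromorphic_on H" if "i \<in> {2..Suc K}" for i
      by (rule meromorphic_on_compose[OF g(1)])
         (use that in \<open>auto simp: H_def intro!: analytic_intros\<close>)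
    have F: "(\<lambda>s. falling_factorial i (1 - s)) meromorphic_on H" for i
      by (intro analytic_on_imp_meromorphic_on)
         (auto intro!: holomorphic_intros simp: H_def analytic_on_open open_halfspace_Re_gt)
    have "h meromorphic_on H"
      unfolding h_def
      by (intro meromorphic_intros R G F meromorphic_on_subset[OF T]) auto
    moreover have "h s = series s" if s: "Re s > 1" for s
    proof -
      have "h s = ((s - 1) * series s) / (s - 1)"
        unfolding h_def series_functional_equation[OF s _ sums[OF s], of "Suc K", simplified]
        using s by (intro arg_cong2[where f = "(/)"] arg_cong2[where f = "(+)"] sum.cong refl) (auto simp: g(2))
      moreover have "s \<noteq> 1" using s by auto
      ultimately show ?thesis by simp
    qed
    ultimately show ?case unfolding H_def by blast
  qed
qed

end

section \<open>The continuation near s = 1\<close>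

context logarithmic_coefficients
begin

text \<open>With \<open>w = 1 - s\<close> both sides agree for Re s > 1. The right side is
  meromorphic on the connected half plane Re s > 0 and continuous away from 1, so the identity
  theorem applies.\<close>

lemma continuation_eq_regular_part:
  assumes g: "g nicely_meromorphic_on UNIV" "\<And>s. Re s > 1 \<Longrightarrow> g s = series s"
    and s: "Re s > 0" "s \<noteq> 1"
  shows "g s = \<alpha> / (s - 1)\<^sup>2 + \<beta> / (s - 1) + regular_part (1 - s)"
proof (rule nicely_meromorphic_eq_isCont[where A = "{s. Re s > 0}" and ?z0.0 = 2 and z = s and g = g
    and f = "\<lambda>s. \<alpha> / (s - 1)\<^sup>2 + \<beta> / (s - 1) + regular_part (1 - s)"])
  have hol: "(\<lambda>s. regular_part (1 - s)) holomorphic_on {s. Re s > 0}"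
    using holomorphic_on_compose_gen[OF _ regular_part_holomorphic, of "\<lambda>s. 1 - s" "{s. Re s > 0}"]
    by (simp add: o_def image_subset_iff holomorphic_on_diff)
  hence ana: "(\<lambda>s. regular_part (1 - s)) analytic_on {s. Re s > 0}"
    using open_halfspace_Re_gt[of 0] by (simp add: analytic_on_open)
  show "(\<lambda>s. \<alpha> / (s - 1)\<^sup>2 + \<beta> / (s - 1) + regular_part (1 - s)) meromorphic_on {s. Re s > 0}"
    by (intro meromorphic_intros analytic_on_imp_meromorphic_on[OF ana])
  show "open {s. Re s > 0}" "connected {s. Re s > 0}"
    using open_halfspace_Re_gt[of 0] convex_halfspace_Re_gt[of 0] by (auto intro: convex_connected)
  have "\<forall>\<^sub>F s in at (2::complex). s \<in> {s. Re s > 1}"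
    using open_halfspace_Re_gt[of 1] by (intro eventually_at_in_open') auto
  thus "\<forall>\<^sub>F s in at 2. g s = \<alpha> / (s - 1)\<^sup>2 + \<beta> / (s - 1) + regular_part (1 - s)"
  proof eventually_elim
    case (elim s)
    have e: "(1 - s)\<^sup>2 = (s - 1)\<^sup>2" "\<beta> / (1 - s) = - (\<beta> / (s - 1))"
      by (rule power2_commute) (simp flip: divide_minus_right)
    have r: "regular_part (1 - s) = series s - \<alpha> / (1 - s)\<^sup>2 + \<beta> / (1 - s)" and "g s = series s"
      using elim regular_part_eq_series[of "1 - s"] by (simp_all add: g(2))
    thus ?case unfolding r e by simp
  qed
  have "isCont (\<lambda>s. regular_part (1 - s)) s"
    using hol s open_halfspace_Re_gt[of 0]
    by (metis (no_types, lifting) continuous_on_eq_continuous_at holomorphic_on_imp_continuous_on mem_Collect_eq)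
  thus "isCont (\<lambda>s. \<alpha> / (s - 1)\<^sup>2 + \<beta> / (s - 1) + regular_part (1 - s)) s"
    using s by (intro continuous_intros) auto
qed (use g s in \<open>auto intro: nicely_meromorphic_on_subset\<close>)

lemma regular_part_power_series:
  assumes "norm w < 1"
  shows "(\<lambda>m. (deriv ^^ m) regular_part 0 / fact m * w ^ m) sums regular_part w"
proof -
  have "ball 0 1 \<subseteq> {w. Re w < 1}"
    using complex_Re_le_cmod by (auto intro: le_less_trans[OF complex_Re_le_cmod])
  hence "regular_part holomorphic_on ball 0 1"
    using regular_part_holomorphic holomorphic_on_subset by blast
  from holomorphic_power_series[OF this, of w] assms show ?thesis by simp
qed

text \<open>This makes the boundary terms vanish when the series for \<open>T\<close> are telescoped
  or summed by parts. Half of the excess \<open>Re s - 1\<close> pays for the growth of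
  \<open>c n\<close>, the other half for the decay.\<close>

lemma coeff_times_power_tendsto_0:
  assumes s: "Re s > 1"
  shows "(\<lambda>n. c n * of_real (real n + a) powr (1 - s)) \<longlonglongrightarrow> 0"
proof (rule Lim_null_comparison)
  define e where "e = (Re s - 1) / 2"
  have e: "e > 0" using s by (simp add: e_def)
  show "\<forall>\<^sub>F n in sequentially. norm (c n * of_real (real n + a) powr (1 - s)) \<le> (real n + a) powr (-e)"
    using coeff_growth[OF e]
  proof eventually_elim
    case (elim n)
    have "norm (c n * of_real (real n + a) powr (1 - s)) \<le> (real n + a) powr e * (real n + a) powr (1 - Re s)"
      using elim unfolding norm_mult norm_powr by (auto intro!: mult_right_mono)
    also have "\<dots> = (real n + a) powr (-e)"
    proof -
      have "e + (1 - Re s) = - e" by (simp add: e_def field_simps)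
      thus ?thesis by (simp only: flip: powr_add)
    qed
    finally show ?case .
  qed
  show "(\<lambda>n. (real n + a) powr (-e)) \<longlonglongrightarrow> 0"
    using e by real_asymp
qed

end

subsection \<open>The Hurwitz and harmonic Hurwitz zeta functions\<close>

lemma logarithmic_coefficients_one: "a > 0 \<Longrightarrow> logarithmic_coefficients a (\<lambda>_. 1) 0 1 0"
  by unfold_locales auto

lemma hurwitz_zeta_continuation:
  fixes a :: real
  assumes a: "a > 0"
  shows "(\<lambda>s. hurwitz_zeta s (of_real a)) nicely_meromorphic_on UNIV"
    and "Re s > 1 \<Longrightarrow> hurwitz_zeta s (of_real a) = logarithmic_coefficients.series a (\<lambda>_. 1) s"
proof -
  interpret Z: logarithmic_coefficients a "\<lambda>_. 1" 0 1 0
    using a by (rule logarithmic_coefficients_one)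
  have "\<exists>g. g nicely_meromorphic_on UNIV \<and> (\<forall>s\<in>{s. Re s > 1}. g s = Z.series s)"
  proof (rule Z.series_meromorphic_continuation)
    have "(\<lambda>s. of_real a powr (1 - s) :: complex) holomorphic_on UNIV"
      using a by (auto intro!: holomorphic_intros)
    thus "(\<lambda>s. of_real a powr (1 - s)) meromorphic_on UNIV"
      by (intro analytic_on_imp_meromorphic_on) (simp add: analytic_on_open)
  next
    fix s :: complex assume "Re s > 1"
    from telescope_sums'[OF Z.coeff_times_power_tendsto_0[OF this]]
    show "(\<lambda>n. 1 * (of_real (real n + a) powr (1 - s) - of_real (real (Suc n) + a) powr (1 - s)))
        sums (of_real a powr (1 - s))" by simp
  qed
  then obtain g where g: "g nicely_meromorphic_on UNIV" "\<And>s. s \<in> {s. Re s > 1} \<Longrightarrow> g s = Z.series s"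
    by blast
  have "Z.series = (\<lambda>s. \<Sum>n. (of_nat n + of_real a) powr (-s))"
    by (simp add: Z.series_def fun_eq_iff)
  with meromorphic_continuationI[OF g, where A = "{s. Re s > 1}"]
  show "(\<lambda>s. hurwitz_zeta s (of_real a)) nicely_meromorphic_on UNIV"
    and "Re s > 1 \<Longrightarrow> hurwitz_zeta s (of_real a) = Z.series s"
    unfolding hurwitz_zeta_def by simp_all
qed

text \<open>Near 1 the Hurwitz zeta function is \<open>1 / (s - 1)\<close> plus the regular part at
  \<open>1 - s\<close>, so its constant Laurent coefficient is the value of the regular part at
  0.\<close>

lemma gamma0_eq_regular_part:
  fixes a :: real
  assumes a: "a > 0"
  shows "gamma0 (of_real a) = logarithmic_coefficients.regular_part a (\<lambda>_. 1) 0 1 0"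
proof -
  interpret Z: logarithmic_coefficients a "\<lambda>_. 1" 0 1 0
    using a by (rule logarithmic_coefficients_one)
  \<comment> \<open>The Laurent variable is \<open>x = s - 1\<close>, whereas
    \<open>regular_part\<close> is a function of \<open>1 - s\<close>.\<close>
  define f where "f = (\<lambda>x. Z.regular_part (- x))"
  have "f holomorphic_on ball 0 1"
  proof -
    have "- Re x < 1" if "norm x < 1" for x :: complex
      using that abs_Re_le_cmod[of x] by linarith
    thus ?thesis
      unfolding f_def
      using holomorphic_on_compose_gen[OF _ Z.regular_part_holomorphic, of "\<lambda>x. - x" "ball 0 1"]
      by (simp add: o_def image_subset_iff holomorphic_on_minus)
  qed
  hence F: "f has_fps_expansion fps_expansion f 0"
    by (intro has_fps_expansion_fps_expansion[of "ball 0 1"]) auto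
  have "(\<lambda>x. inverse x + f x) has_laurent_expansion inverse fls_X + fps_to_fls (fps_expansion f 0)"
    by (intro laurent_expansion_intros has_laurent_expansion_fps F)
  also have "?this \<longleftrightarrow> (\<lambda>x. hurwitz_zeta (1 + x) (of_real a)) has_laurent_expansion
      inverse fls_X + fps_to_fls (fps_expansion f 0)"
  proof (rule has_laurent_expansion_cong)
    have "\<forall>\<^sub>F x in at 0. x \<in> ball (0::complex) 1 - {0}"
      by (intro eventually_at_in_open) auto
    thus "\<forall>\<^sub>F x in at 0. inverse x + f x = hurwitz_zeta (1 + x) (of_real a)"
    proof eventually_elim
      case (elim x)
      have "Re (1 + x) > 0" using elim abs_Re_le_cmod[of x] by auto
      from Z.continuation_eq_regular_part[OF hurwitz_zeta_continuation[OF a] this] elim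
      show ?case by (simp add: f_def inverse_eq_divide)
    qed
  qed auto
  finally have "laurent_expansion (\<lambda>s. hurwitz_zeta s (of_real a)) 1
      = inverse fls_X + fps_to_fls (fps_expansion f 0)"
    by (rule laurent_expansion_eqI)
  thus ?thesis
    by (simp add: gamma0_def fps_expansion_def f_def fls_inverse_X)
qed

section \<open>Asymptotics of the harmonic sums\<close>

lemma harmonic_sum_of_real: "harmonic_sum n (of_real a) = of_real (\<Sum>k\<le>n. 1 / (real k + a))"
  by (simp add: harmonic_sum_def)

text \<open>The case \<open>m = 0\<close> of the coefficient limit, for constant coefficients 1. As
  a limit of real numbers, \<open>gamma0\<close> is real.\<close>

lemma harmonic_sum_minus_ln_tendsto:
  fixes a :: real
  assumes a: "a > 0"
  obtains \<gamma> where "gamma0 (of_real a) = of_real \<gamma>"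
    "(\<lambda>N. (\<Sum>k\<le>N. 1 / (real k + a)) - ln (real N + a)) \<longlonglongrightarrow> \<gamma>"
proof
  interpret Z: logarithmic_coefficients a "\<lambda>_. 1" 0 1 0
    using a by (rule logarithmic_coefficients_one)
  have lim: "(\<lambda>N. of_real ((\<Sum>k\<le>N. 1 / (real k + a)) - ln (real N + a))) \<longlonglongrightarrow> gamma0 (of_real a)"
    using Z.regular_part_coefficient_limit[of 0] by (simp add: gamma0_eq_regular_part[OF a])
  from tendsto_Re[OF this]
  show *: "(\<lambda>N. (\<Sum>k\<le>N. 1 / (real k + a)) - ln (real N + a)) \<longlonglongrightarrow> Re (gamma0 (of_real a))"
    by simp
  show "gamma0 (of_real a) = of_real (Re (gamma0 (of_real a)))"
    using lim tendsto_of_real[OF *, where ?'a = complex] by (rule LIMSEQ_unique)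
qed

text \<open>
  The sequences \<open>d\<close> and \<open>e\<close> below converge to \<open>\<gamma>(0, a)\<close> from above and from below, and they differ
  by at most \<open>1 / (n + a)\<close>.
\<close>

lemma harmonic_sum_asymp:
  fixes a :: real
  assumes a: "a > 0"
  shows "norm (harmonic_sum n (of_real a) - (1 * of_real (ln (real n + a)) + gamma0 (of_real a)))
    \<le> 1 / (real n + a)"
proof -
  obtain \<gamma> where \<gamma>: "gamma0 (of_real a) = of_real \<gamma>"
    "(\<lambda>N. (\<Sum>k\<le>N. 1 / (real k + a)) - ln (real N + a)) \<longlonglongrightarrow> \<gamma>"
    using harmonic_sum_minus_ln_tendsto[OF a] .
  define d where "d = (\<lambda>N. (\<Sum>k\<le>N. 1 / (real k + a)) - ln (real N + a))"
  define e where "e = (\<lambda>N. d N - ln (1 + 1 / (real N + a)))"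
  have lim_d: "d \<longlonglongrightarrow> \<gamma>" unfolding d_def by (rule \<gamma>)
  have "(\<lambda>N. ln (1 + 1 / (real N + a))) \<longlonglongrightarrow> 0"
    by real_asymp
  from tendsto_diff[OF lim_d this] have lim_e: "e \<longlonglongrightarrow> \<gamma>"
    by (simp add: e_def)
  have pos: "real N + a > 0" for N using a by (simp add: add_nonneg_pos)
  have e_eq: "e N = (\<Sum>k\<le>N. 1 / (real k + a)) - ln (real N + a + 1)" for N
  proof -
    have "1 + 1 / (real N + a) = (real N + a + 1) / (real N + a)"
      using pos[of N] by (simp add: field_simps)
    thus ?thesis using pos[of N] by (simp add: e_def d_def ln_div)
  qed
  have "decseq d"
  proof (rule decseq_SucI)
    fix N
    have y: "real N + a > 0" "real N + a + 1 > 0" using pos[of N] by auto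
    \<comment> \<open>With \<open>y = N + a\<close>, the difference \<open>d (Suc N) - d N\<close>
      is \<open>1 / (y + 1) + ln (y / (y + 1))\<close>.\<close>
    have "ln ((real N + a) / (real N + a + 1)) \<le> (real N + a) / (real N + a + 1) - 1"
      using y by (intro ln_le_minus_one) auto
    also have "\<dots> = - (1 / (real N + a + 1))" using y by (simp add: field_simps)
    finally show "d (Suc N) \<le> d N"
      using y by (simp add: d_def ln_div add_ac)
  qed
  hence d_ge: "\<gamma> \<le> d n" using lim_d by (rule decseq_ge)
  have "incseq e"
  proof (rule incseq_SucI)
    fix N
    have y: "real N + a + 1 > 0" "real N + a + 2 > 0" using pos[of N] by auto
    have "ln ((real N + a + 2) / (real N + a + 1)) \<le> (real N + a + 2) / (real N + a + 1) - 1"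
      using y by (intro ln_le_minus_one) auto
    also have "\<dots> = 1 / (real N + a + 1)" using y by (simp add: field_simps)
    finally show "e N \<le> e (Suc N)"
      using y by (simp add: e_eq ln_div add_ac)
  qed
  hence "e n \<le> \<gamma>" using lim_e by (rule incseq_le)
  hence "d n - \<gamma> \<le> ln (1 + 1 / (real n + a))" by (simp add: e_def)
  also have "\<dots> \<le> 1 / (real n + a)"
    using pos[of n] by (intro ln_add_one_self_le_self) auto
  finally have "\<bar>d n - \<gamma>\<bar> \<le> 1 / (real n + a)" using d_ge by simp
  moreover have "harmonic_sum n (of_real a) - (1 * of_real (ln (real n + a)) + gamma0 (of_real a))
      = of_real (d n - \<gamma>)"
    by (simp add: harmonic_sum_of_real d_def \<gamma>(1))
  ultimately show ?thesis by (simp only: norm_of_real)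
qed

lemma logarithmic_coefficients_harmonic_sum:
  "a > 0 \<Longrightarrow> logarithmic_coefficients a (\<lambda>n. harmonic_sum n (of_real a)) 1 (gamma0 (of_real a)) 1"
  using harmonic_sum_asymp by unfold_locales auto

text \<open>Here the function \<open>T\<close> of the functional equation is the Hurwitz zeta
  function, whose continuation is already available.\<close>

lemma harmonic_hurwitz_zeta_continuation:
  fixes a :: real
  assumes a: "a > 0"
  shows "(\<lambda>s. harmonic_hurwitz_zeta s (of_real a)) nicely_meromorphic_on UNIV"
    and "Re s > 1 \<Longrightarrow> harmonic_hurwitz_zeta s (of_real a)
      = logarithmic_coefficients.series a (\<lambda>n. harmonic_sum n (of_real a)) s"
proof -
  interpret Z: logarithmic_coefficients a "\<lambda>_. 1" 0 1 0
    using a by (rule logarithmic_coefficients_one)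
  interpret H: logarithmic_coefficients a "\<lambda>n. harmonic_sum n (of_real a)" 1 "gamma0 (of_real a)" 1
    using a by (rule logarithmic_coefficients_harmonic_sum)
  have "\<exists>g. g nicely_meromorphic_on UNIV \<and> (\<forall>s\<in>{s. Re s > 1}. g s = H.series s)"
  proof (rule H.series_meromorphic_continuation)
    show "(\<lambda>s. hurwitz_zeta s (of_real a)) meromorphic_on UNIV"
      using hurwitz_zeta_continuation(1)[OF a] by (simp add: nicely_meromorphic_on_def)
  next
    fix s :: complex assume s: "Re s > 1"
    define p where "p = (\<lambda>n. of_real (real n + a) :: complex)"
    define h where "h = (\<lambda>n. harmonic_sum n (of_real a))"
    have h_Suc: "h (Suc n) * p (Suc n) powr (1 - s) = h n * p (Suc n) powr (1 - s) + p (Suc n) powr (-s)" for n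
    proof -
      have "p (Suc n) \<noteq> 0" unfolding p_def using H.nonzero[of "Suc n"] by (simp only: of_real_eq_0_iff not_False_eq_True)
      moreover have "h (Suc n) = h n + 1 / p (Suc n)"
        by (simp add: h_def p_def harmonic_sum_def)
      moreover from calculation have "p (Suc n) powr (1 - s) = p (Suc n) * p (Suc n) powr (-s)"
        using powr_add[of "p (Suc n)" 1 "-s"] by simp
      ultimately show ?thesis by (simp add: algebra_simps)
    qed
    \<comment> \<open>Summation by parts: the difference
      \<open>h (Suc n) - h n = 1 / p (Suc n)\<close> lowers the exponent from \<open>1 - s\<close>
      to \<open>-s\<close>, and the boundary term tends to 0.\<close>
    have partial: "(\<Sum>n<N. h n * (p n powr (1 - s) - p (Suc n) powr (1 - s)))
        = (\<Sum>n\<le>N. 1 * p n powr (-s)) - h N * p N powr (1 - s)" for N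
    proof (induction N)
      case 0
      have "of_real a powr (1 - s) = of_real a * (of_real a powr (-s) :: complex)"
        using powr_add[of "of_real a :: complex" 1 "-s"] a by simp
      thus ?case using a by (simp add: h_def p_def harmonic_sum_def)
    next
      case (Suc N)
      thus ?case using h_Suc[of N] by (simp add: algebra_simps)
    qed
    have "(\<lambda>N. (\<Sum>n\<le>N. 1 * p n powr (-s)) - h N * p N powr (1 - s)) \<longlonglongrightarrow> Z.series s - 0"
      using Z.series_sums[OF s] H.coeff_times_power_tendsto_0[OF s]
      unfolding p_def h_def sums_def_le by (rule tendsto_diff)
    hence "(\<lambda>n. h n * (p n powr (1 - s) - p (Suc n) powr (1 - s))) sums Z.series s"
      by (simp add: sums_def partial)
    thus "(\<lambda>n. harmonic_sum n (of_real a) * (of_real (real n + a) powr (1 - s)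
        - of_real (real (Suc n) + a) powr (1 - s))) sums hurwitz_zeta s (of_real a)"
      unfolding h_def p_def hurwitz_zeta_continuation(2)[OF a s] .
  qed
  then obtain g where g: "g nicely_meromorphic_on UNIV" "\<And>s. s \<in> {s. Re s > 1} \<Longrightarrow> g s = H.series s"
    by blast
  have "H.series = (\<lambda>s. \<Sum>n. harmonic_sum n (of_real a) / (of_nat n + of_real a) powr s)"
    by (simp add: H.series_def fun_eq_iff powr_minus divide_inverse)
  with meromorphic_continuationI[OF g, where A = "{s. Re s > 1}"]
  show "(\<lambda>s. harmonic_hurwitz_zeta s (of_real a)) nicely_meromorphic_on UNIV"
    and "Re s > 1 \<Longrightarrow> harmonic_hurwitz_zeta s (of_real a) = H.series s"
    unfolding harmonic_hurwitz_zeta_def by simp_all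
qed

text \<open>This passes from integer to real cutoffs. The difference is squeezed between 0 and the
  increase of \<open>ln ^ k\<close> over a unit interval, which tends to 0.\<close>

lemma ln_power_floor_tendsto:
  fixes a :: real
  assumes a: "a > 0"
  shows "((\<lambda>x. ln (x + a) ^ k - ln (real (nat \<lfloor>x\<rfloor>) + a) ^ k) \<longlongrightarrow> 0) at_top"
proof (rule tendsto_sandwich)
  have ev: "\<forall>\<^sub>F x::real in at_top. x \<ge> 2" by (rule eventually_ge_at_top)
  have bounds: "0 \<le> ln (real (nat \<lfloor>x\<rfloor>) + a)" "ln (real (nat \<lfloor>x\<rfloor>) + a) \<le> ln (x + a)"
    "0 \<le> ln (x - 1 + a)" "ln (x - 1 + a) \<le> ln (real (nat \<lfloor>x\<rfloor>) + a)" if "x \<ge> 2" for x :: real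
  proof -
    define N where "N = real (nat \<lfloor>x\<rfloor>)"
    have "N \<le> x" "x - 1 \<le> N"
      unfolding N_def using that by linarith+
    thus "0 \<le> ln (real (nat \<lfloor>x\<rfloor>) + a)" "ln (real (nat \<lfloor>x\<rfloor>) + a) \<le> ln (x + a)"
      "0 \<le> ln (x - 1 + a)" "ln (x - 1 + a) \<le> ln (real (nat \<lfloor>x\<rfloor>) + a)"
      unfolding N_def[symmetric] using that a by auto
  qed
  show "\<forall>\<^sub>F x in at_top. 0 \<le> ln (x + a) ^ k - ln (real (nat \<lfloor>x\<rfloor>) + a) ^ k"
    using ev by eventually_elim (use bounds in \<open>auto intro!: power_mono\<close>)
  show "\<forall>\<^sub>F x in at_top. ln (x + a) ^ k - ln (real (nat \<lfloor>x\<rfloor>) + a) ^ k \<le> ln (x + a) ^ k - ln (x - 1 + a) ^ k"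
    using ev by eventually_elim (use bounds in \<open>auto intro!: power_mono\<close>)
  show "((\<lambda>x. ln (x + a) ^ k - ln (x - 1 + a) ^ k) \<longlongrightarrow> 0) at_top"
  proof (cases "k = 0")
    case False
    \<comment> \<open>A real exponent puts the limit in a form accessible to
      \<open>real_asymp\<close>; both logarithms are positive for \<open>x \<ge> 2\<close>.\<close>
    define r where "r = real k"
    have "r > 0" using False by (simp add: r_def)
    hence "((\<lambda>x. ln (x + a) powr r - ln (x - 1 + a) powr r) \<longlongrightarrow> 0) at_top"
      by real_asymp
    moreover have "\<forall>\<^sub>F x in at_top. ln (x + a) powr r - ln (x - 1 + a) powr r = ln (x + a) ^ k - ln (x - 1 + a) ^ k"
      using ev
    proof eventually_elim
      case (elim x)
      have "0 < ln (x + a)" "0 < ln (x - 1 + a)" using elim a by auto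
      thus ?case by (simp add: r_def powr_realpow)
    qed
    ultimately show ?thesis by (rule Lim_transform_eventually)
  qed auto
qed auto

text \<open>The sum up to \<open>x\<close> is the sum up to its floor, so
  \<open>gamma_H_approx\<close> differs from the integer sequence \<open>S\<close> only through the
  powers of logarithms, and these differences tend to 0.\<close>

lemma gamma_H_approx_tendsto:
  fixes a :: real
  assumes a: "a > 0"
  shows "(gamma_H_approx m (of_real a) \<longlongrightarrow> (deriv ^^ m)
    (logarithmic_coefficients.regular_part a (\<lambda>n. harmonic_sum n (of_real a)) 1 (gamma0 (of_real a))) 0) at_top"
proof -
  interpret H: logarithmic_coefficients a "\<lambda>n. harmonic_sum n (of_real a)" 1 "gamma0 (of_real a)" 1
    using a by (rule logarithmic_coefficients_harmonic_sum)
  define S where "S = (\<lambda>N. (\<Sum>n\<le>N. harmonic_sum n (of_real a) * of_real (ln (real n + a)) ^ m / of_real (real n + a))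
      - 1 * of_real (ln (real N + a)) ^ (m + 2) / of_nat (m + 2)
      - gamma0 (of_real a) * of_real (ln (real N + a)) ^ (m + 1) / of_nat (m + 1))"
  define \<Delta> where "\<Delta> = (\<lambda>k x. ln (x + a) ^ k - ln (real (nat \<lfloor>x\<rfloor>) + a) ^ k)"
  have "filterlim (\<lambda>x::real. nat \<lfloor>x\<rfloor>) sequentially at_top"
    by real_asymp
  hence S: "((\<lambda>x::real. S (nat \<lfloor>x\<rfloor>)) \<longlongrightarrow> (deriv ^^ m) H.regular_part 0) at_top"
    using filterlim_compose[OF H.regular_part_coefficient_limit[of m]] by (simp add: S_def)
  have \<Delta>: "((\<lambda>x. of_real (\<Delta> k x)) \<longlongrightarrow> (0::complex)) at_top" for k
    using tendsto_of_real[OF ln_power_floor_tendsto[OF a, of k], where ?'a = complex] by (simp add: \<Delta>_def)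
  have nz: "of_nat (m + 2) \<noteq> (0::complex)" "of_nat (m + 1) \<noteq> (0::complex)"
    by (simp_all only: of_nat_eq_0_iff)
  have "((\<lambda>x. S (nat \<lfloor>x\<rfloor>) - of_real (\<Delta> (m + 2) x) / of_nat (m + 2)
      - gamma0 (of_real a) * of_real (\<Delta> (m + 1) x) / of_nat (m + 1)) \<longlongrightarrow>
      (deriv ^^ m) H.regular_part 0 - 0 / of_nat (m + 2) - gamma0 (of_real a) * 0 / of_nat (m + 1)) at_top"
    by (intro tendsto_intros S \<Delta> nz)
  moreover have "\<forall>\<^sub>F x in at_top. S (nat \<lfloor>x\<rfloor>) - of_real (\<Delta> (m + 2) x) / of_nat (m + 2)
      - gamma0 (of_real a) * of_real (\<Delta> (m + 1) x) / of_nat (m + 1) = gamma_H_approx m (of_real a) x"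
    using eventually_ge_at_top[of 0]
  proof eventually_elim
    case (elim x)
    have set: "{n. real n \<le> x} = {..nat \<lfloor>x\<rfloor>}"
      using elim by (auto simp: le_nat_floor) linarith
    have ln1: "ln (of_nat n + of_real a) = (of_real (ln (real n + a)) :: complex)" for n
      using Ln_of_real[OF H.pos[of n]] by simp
    have ln2: "ln (of_real x + of_real a) = (of_real (ln (x + a)) :: complex)"
      using Ln_of_real[of "x + a"] elim a by simp
    show ?case
      unfolding gamma_H_approx_def set ln1 ln2 S_def \<Delta>_def
      by (simp only: of_real_diff of_real_power of_real_add of_real_of_nat_eq right_diff_distrib diff_divide_distrib) simp
  qed
  ultimately show ?thesis
    by (simp add: tendsto_cong)
qed

theorem theorem1:
  fixes a :: real
  assumes "0 < a" and "a \<le> 1"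
  shows "(\<forall>m. (gamma_H_approx m (of_real a) \<longlongrightarrow> gamma_H m (of_real a)) at_top) \<and>
    (\<forall>s::complex. 0 < norm (s - 1) \<and> norm (s - 1) < 1 \<longrightarrow>
       summable (\<lambda>m. (-1) ^ m * (gamma_H m (of_real a) / fact m) * (s - 1) ^ m) \<and>
       harmonic_hurwitz_zeta s (of_real a) =
         1 / (s - 1)\<^sup>2 + gamma0 (of_real a) / (s - 1)
         + (\<Sum>m. (-1) ^ m * (gamma_H m (of_real a) / fact m) * (s - 1) ^ m))"
proof -
  interpret H: logarithmic_coefficients a "\<lambda>n. harmonic_sum n (of_real a)" 1 "gamma0 (of_real a)" 1
    using assms(1) by (rule logarithmic_coefficients_harmonic_sum)
  have lim: "(gamma_H_approx m (of_real a) \<longlongrightarrow> (deriv ^^ m) H.regular_part 0) at_top" for m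
    using assms(1) by (rule gamma_H_approx_tendsto)
  hence gamma: "gamma_H m (of_real a) = (deriv ^^ m) H.regular_part 0" for m
    unfolding gamma_H_def by (intro tendsto_Lim) auto
  show ?thesis
  proof (intro conjI allI impI)
    show "(gamma_H_approx m (of_real a) \<longlongrightarrow> gamma_H m (of_real a)) at_top" for m
      using lim by (simp add: gamma)
  next
    fix s :: complex assume s: "0 < norm (s - 1) \<and> norm (s - 1) < 1"
    \<comment> \<open>The alternating sign comes from expanding the regular part in powers of
      \<open>1 - s\<close>.\<close>
    have "(-1) ^ m * (gamma_H m (of_real a) / fact m) * (s - 1) ^ m
        = (deriv ^^ m) H.regular_part 0 / fact m * (1 - s) ^ m" for m
      using power_mult_distrib[of "-1" "s - 1" m] by (simp add: gamma)
    hence sums: "(\<lambda>m. (-1) ^ m * (gamma_H m (of_real a) / fact m) * (s - 1) ^ m) sums H.regular_part (1 - s)"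
      using H.regular_part_power_series[of "1 - s"] s by (simp add: norm_minus_commute)
    thus "summable (\<lambda>m. (-1) ^ m * (gamma_H m (of_real a) / fact m) * (s - 1) ^ m)"
      by (rule sums_summable)
    have "Re s > 0" using s abs_Re_le_cmod[of "s - 1"] by auto
    moreover have "s \<noteq> 1" using s by auto
    ultimately show "harmonic_hurwitz_zeta s (of_real a) =
         1 / (s - 1)\<^sup>2 + gamma0 (of_real a) / (s - 1)
         + (\<Sum>m. (-1) ^ m * (gamma_H m (of_real a) / fact m) * (s - 1) ^ m)"
      using H.continuation_eq_regular_part[OF harmonic_hurwitz_zeta_continuation[OF assms(1)]]
        sums_unique[OF sums] by simp
  qed
qed

end
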